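(* For all $1\le m\le n$ and $k\ge1$, the variety $\mathcal Z^{m,n}_{m,k}$ (all maximal minors set to zero) is irreducible, of codimension $k(n-m+1)$ in $\mathbf A^{mnk}$.
   Context: Let $F$ be an algebraically closed field. For integers $1\le r\le m\le n$ and $k\ge 1$, let $S=F[x^{(l)}_{i,j}:1\le i\le m,\ 1\le j\le n,\ 0\le l\le k-1]$, the coordinate ring of $\mathbf A^{mnk}_F$, and let $X(t)$ be the $m\times n$ matrix over $S[t]/(t^k)$ with $(i,j)$ entry $x_{i,j}(t)=\sum_{l=0}^{k-1}x^{(l)}_{i,j}t^l$. Every element of $S[t]/(t^k)$ is uniquely $\sum_{l=0}^{k-1}c_lt^l$ with $c_l\in S$ (its coefficient of $t^l$). $\mathcal I^{m,n}_{r,k}\subseteq S$ is the ideal generated by the coefficients of $t^l$, $0\le l\le k-1$, of all $r\times r$ minors of $X(t)$, and $\mathcal Z^{m,n}_{r,k}\subseteq\mathbf A^{mnk}_F$ is its zero set. *)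

theory Defs
  imports "Jordan_Normal_Form.Determinant" "HOL-Computational_Algebra.Polynomial"
begin

definition alg_closed :: "'a::field itself \<Rightarrow> bool" where
  "alg_closed _ \<longleftrightarrow> (\<forall>p::'a poly. 0 < degree p \<longrightarrow> (\<exists>z. poly p z = 0))"

definition affine_space :: "'v set \<Rightarrow> ('v \<Rightarrow> 'a::field) set" where
  "affine_space V = {x. \<forall>v. v \<notin> V \<longrightarrow> x v = 0}"

text \<open>Polynomial functions on affine space in the variables V (the coordinate ring;
  over an infinite field these are exactly the polynomials).\<close>
inductive_set poly_fun :: "'v set \<Rightarrow> (('v \<Rightarrow> 'a::field) \<Rightarrow> 'a) set" for V where
  const: "(\<lambda>x. c) \<in> poly_fun V"
| var: "v \<in> V \<Longrightarrow> (\<lambda>x. x v) \<in> poly_fun V"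
| add: "p \<in> poly_fun V \<Longrightarrow> q \<in> poly_fun V \<Longrightarrow> (\<lambda>x. p x + q x) \<in> poly_fun V"
| mult: "p \<in> poly_fun V \<Longrightarrow> q \<in> poly_fun V \<Longrightarrow> (\<lambda>x. p x * q x) \<in> poly_fun V"

definition zariski_closed :: "'v set \<Rightarrow> ('v \<Rightarrow> 'a::field) set \<Rightarrow> bool" where
  "zariski_closed V Z \<longleftrightarrow>
     (\<exists>P \<subseteq> poly_fun V. Z = {x \<in> affine_space V. \<forall>p\<in>P. p x = 0})"

definition zariski_irreducible :: "'v set \<Rightarrow> ('v \<Rightarrow> 'a::field) set \<Rightarrow> bool" where
  "zariski_irreducible V Z \<longleftrightarrow> zariski_closed V Z \<and> Z \<noteq> {} \<and>
     (\<forall>Z1 Z2. zariski_closed V Z1 \<longrightarrow> zariski_closed V Z2 \<longrightarrow> Z \<subseteq> Z1 \<union> Z2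
        \<longrightarrow> Z \<subseteq> Z1 \<or> Z \<subseteq> Z2)"

definition irr_chain :: "'v set \<Rightarrow> ('v \<Rightarrow> 'a::field) set \<Rightarrow> nat \<Rightarrow> bool" where
  "irr_chain V Z d \<longleftrightarrow> (\<exists>C :: nat \<Rightarrow> ('v \<Rightarrow> 'a) set.
     (\<forall>i\<le>d. zariski_irreducible V (C i)) \<and> (\<forall>i<d. C i \<subset> C (Suc i)) \<and> C d \<subseteq> Z)"

definition zariski_dim :: "'v set \<Rightarrow> ('v \<Rightarrow> 'a::field) set \<Rightarrow> nat \<Rightarrow> bool" where
  "zariski_dim V Z d \<longleftrightarrow> irr_chain V Z d \<and> \<not> irr_chain V Z (Suc d)"

definition zariski_codim :: "'v set \<Rightarrow> ('v \<Rightarrow> 'a::field) set \<Rightarrow> nat \<Rightarrow> bool" where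
  "zariski_codim V Z c \<longleftrightarrow> c \<le> card V \<and> zariski_dim V Z (card V - c)"

definition jet_vars :: "nat \<Rightarrow> nat \<Rightarrow> nat \<Rightarrow> (nat \<times> nat \<times> nat) set" where
  "jet_vars m n k = {(i,j,l). i < m \<and> j < n \<and> l < k}"

definition jet_entry :: "nat \<Rightarrow> (nat \<times> nat \<times> nat \<Rightarrow> 'a::field) \<Rightarrow> nat \<Rightarrow> nat \<Rightarrow> 'a poly" where
  "jet_entry k x i j = (\<Sum>l<k. monom (x (i,j,l)) l)"

text \<open>The r x r minor of X(t) with rows \<rho>(0)<...<\<rho>(r-1) and columns
  \<gamma>(0)<...<\<gamma>(r-1), evaluated at x. Its coefficients of t^l for l<k coincide with
  those of the minor computed in F[t]/(t^k).\<close>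
definition jet_minor :: "nat \<Rightarrow> nat \<Rightarrow> (nat \<times> nat \<times> nat \<Rightarrow> 'a::field)
    \<Rightarrow> (nat \<Rightarrow> nat) \<Rightarrow> (nat \<Rightarrow> nat) \<Rightarrow> 'a poly" where
  "jet_minor r k x \<rho> \<gamma> = det (mat r r (\<lambda>(a,b). jet_entry k x (\<rho> a) (\<gamma> b)))"

definition jet_det_variety :: "nat \<Rightarrow> nat \<Rightarrow> nat \<Rightarrow> nat \<Rightarrow> (nat \<times> nat \<times> nat \<Rightarrow> 'a::field) set" where
  "jet_det_variety m n r k = {x \<in> affine_space (jet_vars m n k).
     \<forall>\<rho> \<gamma>. strict_mono_on {..<r} \<rho> \<longrightarrow> (\<forall>a<r. \<rho> a < m) \<longrightarrow>
            strict_mono_on {..<r} \<gamma> \<longrightarrow> (\<forall>b<r. \<gamma> b < n) \<longrightarrow>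
            (\<forall>l<k. coeff (jet_minor r k x \<rho> \<gamma>) l = 0)}"

end

theory Submission
  imports Defs "HOL-Computational_Algebra.Polynomial_FPS"
begin

text \<open>Write m = p + 1. The jets whose last row is an F[t]/(t^k)-combination of the first p rows form
  the image of a polynomial map from an affine space of dimension k p (n + 1), and this image is
  dense in the variety: by the Smith form a point is U D V with D diagonal and the product of its
  diagonal entries zero, and for s nonzero U (D + s N) V, with N the superdiagonal, has a left kernel vector with a unit entry; a
  further linear deformation makes the last entry of that vector a unit. Irreducibility follows since
  any two points of the image lie on a polynomial curve inside it. A chain of irreducible closed
  subsets of length d yields d algebraically independent functions, which pull back to the parameter
  space, so d is at most its dimension; freeing the parameters one at a time attains this bound.\<close>

section \<open>Zariski closures and irreducibility\<close>

text \<open>All computations take place in F[[t]], with divisibility by t^k in place of equality in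
  F[t]/(t^k): in F[[t]] divisibility is total and the units are the series with nonzero constant
  term. Passing to a closure is unavoidable. Modulo t^2 the matrix diag(t, t) has determinant 0, yet
  both entries of every left kernel vector are divisible by t, so neither row is a multiple of the
  other. The superdiagonal deformation ties the diagonal entries together, so that the only
  obstruction to a kernel vector is their product. The codimension comes from counting k p n
  coefficients for the free rows and k p for the combination: (p + 1) n - p (n + 1) = n - p = n - m
  + 1.\<close>

definition zariski_closure :: "'v set \<Rightarrow> ('v \<Rightarrow> 'a::field) set \<Rightarrow> ('v \<Rightarrow> 'a) set" where
  "zariski_closure V S = {x \<in> affine_space V. \<forall>p\<in>poly_fun V. (\<forall>y\<in>S. p y = 0) \<longrightarrow> p x = 0}"

lemma zariski_closed_closure: "zariski_closed V (zariski_closure V S)"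
  unfolding zariski_closed_def zariski_closure_def
  by (rule exI[of _ "{p \<in> poly_fun V. \<forall>y\<in>S. p y = 0}"]) auto

lemma zariski_closure_upper: "S \<subseteq> affine_space V \<Longrightarrow> S \<subseteq> zariski_closure V S"
  unfolding zariski_closure_def by auto

lemma zariski_closure_least:
  assumes "zariski_closed V Z" "S \<subseteq> Z"
  shows "zariski_closure V S \<subseteq> Z"
proof -
  from assms obtain P where P: "P \<subseteq> poly_fun V" "Z = {x \<in> affine_space V. \<forall>p\<in>P. p x = 0}"
    unfolding zariski_closed_def by blast
  show ?thesis
  proof
    fix x assume x: "x \<in> zariski_closure V S"
    have "p x = 0" if "p \<in> P" for p
      using that P assms(2) x unfolding zariski_closure_def by blast
    with x show "x \<in> Z" unfolding P(2) zariski_closure_def by auto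
  qed
qed

lemma zariski_closure_mono: "S \<subseteq> T \<Longrightarrow> zariski_closure V S \<subseteq> zariski_closure V T"
  unfolding zariski_closure_def by blast

lemma poly_fun_minus:
  assumes "p \<in> poly_fun V" "q \<in> poly_fun V"
  shows "(\<lambda>x. p x - q x) \<in> poly_fun V"
  using poly_fun.add[OF assms(1) poly_fun.mult[OF poly_fun.const[of "-1"] assms(2)]] by simp

lemma poly_fun_sum:
  "(\<And>i. i \<in> I \<Longrightarrow> f i \<in> poly_fun V) \<Longrightarrow> (\<lambda>x. \<Sum>i\<in>I. f i x) \<in> poly_fun V"
  by (induction I rule: infinite_finite_induct) (auto intro: poly_fun.const poly_fun.add)

lemma poly_fun_power: "f \<in> poly_fun V \<Longrightarrow> (\<lambda>x. f x ^ j) \<in> poly_fun V"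
  by (induction j) (auto intro: poly_fun.const poly_fun.mult)

lemma poly_fun_comp:
  assumes "p \<in> poly_fun V" and "\<And>v. v \<in> V \<Longrightarrow> (\<lambda>w. \<psi> w v) \<in> poly_fun W"
  shows "(\<lambda>w. p (\<psi> w)) \<in> poly_fun W"
  using assms(1) by induction (auto intro: poly_fun.intros assms(2))

text \<open>Reduces vanishing in many variables to roots of one polynomial in \<open>s\<close>.
  Coordinates outside \<open>V\<close> may be arbitrary since \<open>p\<close> never reads
  them.\<close>

lemma poly_fun_curve:
  assumes "p \<in> poly_fun V" and "\<And>v. v \<in> V \<Longrightarrow> \<exists>P. \<forall>s. \<gamma> s v = poly P s"
  shows "\<exists>P. \<forall>s. p (\<gamma> s) = poly P s"
  using assms(1)
proof induction
  case (const c)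
  show ?case by (rule exI[of _ "[:c:]"]) simp
next
  case (var v)
  then show ?case using assms(2) by blast
next
  case (add p q)
  then obtain P Q where "\<forall>s. p (\<gamma> s) = poly P s" "\<forall>s. q (\<gamma> s) = poly Q s" by blast
  then show ?case by (intro exI[of _ "P + Q"]) simp
next
  case (mult p q)
  then obtain P Q where "\<forall>s. p (\<gamma> s) = poly P s" "\<forall>s. q (\<gamma> s) = poly Q s" by blast
  then show ?case by (intro exI[of _ "P * Q"]) simp
qed

text \<open>Over a finite field, 1 plus the product of all X - a would have positive degree and the
  value 1 everywhere.\<close>

lemma alg_closed_infinite:
  assumes "alg_closed TYPE('a::field)"
  shows "infinite (UNIV :: 'a set)"
proof
  assume fin: "finite (UNIV :: 'a set)"
  define q :: "'a poly" where "q = (\<Prod>a\<in>UNIV. [:-a, 1:])"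
  have "degree q = card (UNIV :: 'a set)"
    unfolding q_def by (subst degree_prod_eq_sum_degree) auto
  then have "0 < degree q" using fin by (simp add: card_gt_0_iff)
  then have "degree (q + 1) = degree q" by (simp add: degree_add_eq_left)
  then obtain z where "poly (q + 1) z = 0"
    using assms \<open>0 < degree q\<close> unfolding alg_closed_def by metis
  moreover have "poly q z = 0" unfolding q_def poly_prod using fin by (auto intro: prod_zero)
  ultimately show False by simp
qed

lemma zariski_irreducible_subset_affine: "zariski_irreducible V Z \<Longrightarrow> Z \<subseteq> affine_space V"
  unfolding zariski_irreducible_def zariski_closed_def by auto

text \<open>The zero loci of \<open>p\<close> and \<open>q\<close> cover \<open>Z\<close>, so one of
  them contains it: the vanishing ideal is prime. This permits cancelling a factor in a relation
  that holds on \<open>Z\<close>.\<close>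

lemma zariski_irreducible_mult_zero:
  assumes Z: "zariski_irreducible V Z" and p: "p \<in> poly_fun V" and q: "q \<in> poly_fun V"
    and pq: "\<And>x. x \<in> Z \<Longrightarrow> p x * q x = 0"
  shows "(\<forall>x\<in>Z. p x = 0) \<or> (\<forall>x\<in>Z. q x = 0)"
proof -
  have closed: "zariski_closed V {x \<in> affine_space V. r x = 0}" if "r \<in> poly_fun V" for r
    unfolding zariski_closed_def using that by (intro exI[of _ "{r}"]) auto
  have "Z \<subseteq> {x \<in> affine_space V. p x = 0} \<union> {x \<in> affine_space V. q x = 0}"
    using pq zariski_irreducible_subset_affine[OF Z] by auto
  then show ?thesis using Z closed[OF p] closed[OF q]
    unfolding zariski_irreducible_def by blast
qed

text \<open>If two closed sets cover the closure but neither contains it, each has an equation that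
  is nonzero at some point of \<open>S\<close>. Along a curve in \<open>S\<close> through both
  points these become nonzero polynomials in \<open>s\<close>; their product has finitely many
  roots, so some point of the curve avoids both sets.\<close>

lemma zariski_irreducible_closure:
  fixes S :: "('v \<Rightarrow> 'a::field) set"
  assumes inf: "infinite (UNIV :: 'a set)"
    and SV: "S \<subseteq> affine_space V" and ne: "S \<noteq> {}"
    and conn: "\<And>x y. x \<in> S \<Longrightarrow> y \<in> S \<Longrightarrow> \<exists>\<gamma>. (\<forall>s::'a. \<gamma> s \<in> S) \<and>
      (\<forall>v\<in>V. \<exists>P. \<forall>s. \<gamma> s v = poly P s) \<and> x \<in> range \<gamma> \<and> y \<in> range \<gamma>"
  shows "zariski_irreducible V (zariski_closure V S)"
  unfolding zariski_irreducible_def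
proof (intro conjI allI impI)
  show "zariski_closed V (zariski_closure V S)" by (rule zariski_closed_closure)
  show "zariski_closure V S \<noteq> {}" using zariski_closure_upper[OF SV] ne by blast
  fix Z1 Z2 assume Z1: "zariski_closed V Z1" and Z2: "zariski_closed V Z2"
    and sub: "zariski_closure V S \<subseteq> Z1 \<union> Z2"
  show "zariski_closure V S \<subseteq> Z1 \<or> zariski_closure V S \<subseteq> Z2"
  proof (rule ccontr)
    assume "\<not> ?thesis"
    then obtain x y where x: "x \<in> S" "x \<notin> Z1" and y: "y \<in> S" "y \<notin> Z2"
      using zariski_closure_least[OF Z1] zariski_closure_least[OF Z2] by blast
    obtain P1 where P1: "P1 \<subseteq> poly_fun V" "Z1 = {x \<in> affine_space V. \<forall>p\<in>P1. p x = 0}"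
      using Z1 unfolding zariski_closed_def by blast
    obtain P2 where P2: "P2 \<subseteq> poly_fun V" "Z2 = {x \<in> affine_space V. \<forall>p\<in>P2. p x = 0}"
      using Z2 unfolding zariski_closed_def by blast
    obtain p where p: "p \<in> P1" "p x \<noteq> 0" using x SV P1 by blast
    obtain q where q: "q \<in> P2" "q y \<noteq> 0" using y SV P2 by blast
    obtain \<gamma> where \<gamma>: "\<And>s::'a. \<gamma> s \<in> S" "\<And>v. v \<in> V \<Longrightarrow> \<exists>P. \<forall>s. \<gamma> s v = poly P s"
      "x \<in> range \<gamma>" "y \<in> range \<gamma>" using conn[OF x(1) y(1)] by blast
    obtain P where P: "\<And>s. p (\<gamma> s) = poly P s" using poly_fun_curve[of p V \<gamma>] p(1) P1(1) \<gamma>(2) by blast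
    obtain Q where Q: "\<And>s. q (\<gamma> s) = poly Q s" using poly_fun_curve[of q V \<gamma>] q(1) P2(1) \<gamma>(2) by blast
    have "P \<noteq> 0" using P p(2) \<gamma>(3) by force
    moreover have "Q \<noteq> 0" using Q q(2) \<gamma>(4) by force
    ultimately have "finite {s. poly (P * Q) s = 0}" by (intro poly_roots_finite) simp
    then obtain s where "poly (P * Q) s \<noteq> 0" using inf by (metis (mono_tags) finite_subset subsetI mem_Collect_eq)
    then have "p (\<gamma> s) \<noteq> 0" "q (\<gamma> s) \<noteq> 0" using P Q by auto
    then have "\<gamma> s \<notin> Z1 \<union> Z2" using p(1) q(1) unfolding P1(2) P2(2) by blast
    then show False using sub \<gamma>(1) zariski_closure_upper[OF SV] by blast
  qed
qed

text \<open>Formulated for any \<open>L\<close> containing the line through two of its points, which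
  covers the full parameter space as well as the subspaces with some parameters frozen that form the
  chain.\<close>

lemma zariski_irreducible_closure_image:
  fixes \<psi> :: "('w \<Rightarrow> 'a::field) \<Rightarrow> ('v \<Rightarrow> 'a)"
  assumes inf: "infinite (UNIV :: 'a set)"
    and \<psi>V: "\<And>w. \<psi> w \<in> affine_space V"
    and \<psi>: "\<And>v. v \<in> V \<Longrightarrow> (\<lambda>w. \<psi> w v) \<in> poly_fun W"
    and ne: "L \<noteq> {}"
    and line: "\<And>x y s. x \<in> L \<Longrightarrow> y \<in> L \<Longrightarrow> (\<lambda>v. x v + s * (y v - x v)) \<in> L"
  shows "zariski_irreducible V (zariski_closure V (\<psi> ` L))"
proof (rule zariski_irreducible_closure[OF inf])
  show "\<psi> ` L \<subseteq> affine_space V" using \<psi>V by blast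
  show "\<psi> ` L \<noteq> {}" using ne by blast
  fix a b assume "a \<in> \<psi> ` L" "b \<in> \<psi> ` L"
  then obtain x y where x: "x \<in> L" "a = \<psi> x" and y: "y \<in> L" "b = \<psi> y" by blast
  define \<delta> where "\<delta> s = (\<lambda>v. x v + s * (y v - x v))" for s
  have "\<exists>P. \<forall>s. \<delta> s v = poly P s" for v
    unfolding \<delta>_def by (rule exI[of _ "[:x v, y v - x v:]"]) simp
  then have "\<exists>P. \<forall>s. \<psi> (\<delta> s) v = poly P s" if "v \<in> V" for v
    using poly_fun_curve[OF \<psi>[OF that], of \<delta>] by blast
  moreover have "\<delta> 0 = x" "\<delta> 1 = y" unfolding \<delta>_def by auto
  then have "a \<in> range (\<lambda>s. \<psi> (\<delta> s))" "b \<in> range (\<lambda>s. \<psi> (\<delta> s))" using x(2) y(2) by (metis rangeI)+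
  moreover have "\<delta> s \<in> L" for s unfolding \<delta>_def using line x(1) y(1) by blast
  ultimately show "\<exists>\<gamma>. (\<forall>s. \<gamma> s \<in> \<psi> ` L) \<and> (\<forall>v\<in>V. \<exists>P. \<forall>s. \<gamma> s v = poly P s) \<and> a \<in> range \<gamma> \<and> b \<in> range \<gamma>"
    by (intro exI[of _ "\<lambda>s. \<psi> (\<delta> s)"]) auto
qed

section \<open>Upper bounds on the dimension\<close>

text \<open>The head of a list of length l + 1 is the exponent of \<open>f l\<close>, the last
  function, so splitting off the head separates its powers from monomials in the earlier
  functions.\<close>

fun exp_monom :: "(nat \<Rightarrow> 'b \<Rightarrow> 'a::comm_semiring_1) \<Rightarrow> nat list \<Rightarrow> 'b \<Rightarrow> 'a" where
  "exp_monom f [] x = 1"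
| "exp_monom f (j # a) x = f (length a) x ^ j * exp_monom f a x"

text \<open>Bounding each exponent, not the total degree, makes the number of lists an exact
  power.\<close>

definition exponents :: "nat \<Rightarrow> nat \<Rightarrow> nat list set" where
  "exponents l N = {a. set a \<subseteq> {..N} \<and> length a = l}"

lemma finite_exponents: "finite (exponents l N)"
  unfolding exponents_def by (rule finite_lists_length_eq) simp

lemma card_exponents: "card (exponents l N) = Suc N ^ l"
  unfolding exponents_def by (subst card_lists_length_eq) auto

lemma exponents_0: "exponents 0 N = {[]}"
  unfolding exponents_def by auto

lemma exponents_Suc: "exponents (Suc l) N = (\<lambda>(j, a). j # a) ` ({..N} \<times> exponents l N)"
  unfolding exponents_def by (auto simp: length_Suc_conv image_iff)

lemma sum_exponents_Suc:
  "(\<Sum>a\<in>exponents (Suc l) N. g a) = (\<Sum>j<Suc N. \<Sum>a\<in>exponents l N. g (j # a))"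
proof -
  have "inj_on (\<lambda>(j, a). j # a) ({..N} \<times> exponents l N)" by (auto simp: inj_on_def)
  then have "(\<Sum>a\<in>exponents (Suc l) N. g a) = (\<Sum>(j, a)\<in>{..N} \<times> exponents l N. g (j # a))"
    unfolding exponents_Suc by (subst sum.reindex) (auto simp: o_def intro!: sum.cong)
  then show ?thesis by (simp add: sum.cartesian_product lessThan_Suc_atMost)
qed

lemma exp_monom_poly_fun:
  "(\<And>i. i < length a \<Longrightarrow> f i \<in> poly_fun V) \<Longrightarrow> exp_monom f a \<in> poly_fun V"
proof (induction a)
  case Nil
  have "exp_monom f [] = (\<lambda>x. 1)" by auto
  then show ?case using poly_fun.const by metis
next
  case (Cons j a)
  have "(\<lambda>x. f (length a) x ^ j * exp_monom f a x) \<in> poly_fun V"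
    using Cons by (intro poly_fun.mult poly_fun_power) auto
  moreover have "exp_monom f (j # a) = (\<lambda>x. f (length a) x ^ j * exp_monom f a x)" by auto
  ultimately show ?case by simp
qed

text \<open>A function cutting out each step of a chain of irreducible closed sets gives algebraically
  independent functions: a relation is divided by the last function as often as possible and
  then restricted to the previous member of the chain.\<close>

lemma chain_algebraically_independent:
  fixes f :: "nat \<Rightarrow> ('v \<Rightarrow> 'a::field) \<Rightarrow> 'a"
  assumes "\<And>i. i \<le> l \<Longrightarrow> zariski_irreducible V (C i)"
    and "\<And>i. i < l \<Longrightarrow> C i \<subseteq> C (Suc i)"
    and "\<And>i. i < l \<Longrightarrow> f i \<in> poly_fun V"
    and "\<And>i x. i < l \<Longrightarrow> x \<in> C i \<Longrightarrow> f i x = 0"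
    and "\<And>i. i < l \<Longrightarrow> \<exists>x\<in>C (Suc i). f i x \<noteq> 0"
    and "\<And>x. x \<in> C l \<Longrightarrow> (\<Sum>a\<in>exponents l N. c a * exp_monom f a x) = 0"
    and "a \<in> exponents l N"
  shows "c a = 0"
  using assms
proof (induction l arbitrary: c a)
  case 0
  have "C 0 \<noteq> {}" using 0(1)[of 0] unfolding zariski_irreducible_def by simp
  then show ?case using 0(6,7) by (auto simp: exponents_0)
next
  case (Suc l)
  note irr = Suc.prems(1) and sub = Suc.prems(2)[of l] and pf = Suc.prems(3)
    and f0 = Suc.prems(4)[of l] and f1 = Suc.prems(5)[of l]
  define g where "g d x = (\<Sum>a\<in>exponents l N. d a * exp_monom f a x)" for d x
  have IH: "d a = 0" if "\<And>x. x \<in> C l \<Longrightarrow> g d x = 0" "a \<in> exponents l N" for d a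
    by (rule Suc.IH) (use Suc.prems(1-5) that in \<open>auto simp: g_def\<close>)
  have g: "g d \<in> poly_fun V" for d
    unfolding g_def
    by (intro poly_fun_sum poly_fun.mult poly_fun.const exp_monom_poly_fun pf)
      (auto simp: exponents_def)
  \<comment> \<open>The relation is sorted by powers of \<open>f l\<close>. On \<open>C l\<close>
    only the term without \<open>f l\<close> survives, and the outer induction kills its
    coefficients; irreducibility of \<open>C (Suc l)\<close> then permits cancelling one factor
    \<open>f l\<close>, which shifts \<open>d\<close>.\<close>
  have *: "d j a = 0" if "\<And>x. x \<in> C (Suc l) \<Longrightarrow> (\<Sum>j<M. f l x ^ j * g (d j) x) = 0" "j < M"
      "a \<in> exponents l N" for d M j a
    using that
  proof (induction M arbitrary: d j)
    case (Suc M)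
    define h where "h x = (\<Sum>j<M. f l x ^ j * g (d (Suc j)) x)" for x
    have h: "h \<in> poly_fun V"
      unfolding h_def by (intro poly_fun_sum poly_fun.mult poly_fun_power pf g) auto
    have "(\<Sum>j<Suc M. f l x ^ j * g (d j) x) = g (d 0) x + f l x * h x" for x
      unfolding h_def by (subst sum.lessThan_Suc_shift) (simp add: sum_distrib_left ac_simps)
    then have eq: "g (d 0) x + f l x * h x = 0" if "x \<in> C (Suc l)" for x
      using Suc.prems(1)[OF that] by simp
    have "g (d 0) x = 0" if x: "x \<in> C l" for x
      using eq[of x] f0[OF _ x] sub x by auto
    then have d0: "d 0 a = 0" if "a \<in> exponents l N" for a using IH[of "d 0"] that by blast
    then have "g (d 0) x = 0" for x by (simp add: g_def)
    then have "f l x * h x = 0" if "x \<in> C (Suc l)" for x using eq[OF that] by simp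
    then have "\<forall>x\<in>C (Suc l). h x = 0"
      using zariski_irreducible_mult_zero[OF irr[of "Suc l"] pf[of l] h] f1 by blast
    then have "d (Suc j) a = 0" if "j < M" for j
      using Suc.IH[of "\<lambda>j. d (Suc j)" j] Suc.prems(3) that unfolding h_def by blast
    then show ?case using d0 Suc.prems(2,3) by (cases j) auto
  qed simp
  have "(\<Sum>j<Suc N. f l x ^ j * g (\<lambda>a. c (j # a)) x) = 0" if "x \<in> C (Suc l)" for x
  proof -
    have "(\<Sum>j<Suc N. f l x ^ j * g (\<lambda>a. c (j # a)) x)
        = (\<Sum>a\<in>exponents (Suc l) N. c a * exp_monom f a x)"
      unfolding sum_exponents_Suc sum_distrib_left g_def
      by (intro sum.cong refl) (auto simp: exponents_def)
    then show ?thesis using Suc.prems(6)[OF that] by simp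
  qed
  moreover obtain j b where "a = j # b" "j < Suc N" "b \<in> exponents l N"
    using Suc.prems(7) unfolding exponents_Suc by auto
  ultimately show ?case using *[of "\<lambda>j a. c (j # a)" "Suc N" j b] by blast
qed

section \<open>Algebraic dependence by counting coefficients\<close>

lemma underdetermined_system:
  fixes A :: "'i \<Rightarrow> 't \<Rightarrow> 'a::field"
  assumes "finite T" "finite I" "card T < card I"
  shows "\<exists>c. (\<exists>i\<in>I. c i \<noteq> 0) \<and> (\<forall>t\<in>T. (\<Sum>i\<in>I. c i * A i t) = 0)"
  using assms
proof (induction T arbitrary: I A rule: finite_induct)
  case empty
  then show ?case by (intro exI[of _ "\<lambda>_. 1"]) (auto simp: card_gt_0_iff)
next
  case (insert t T)
  show ?case
  proof (cases "\<forall>i\<in>I. A i t = 0")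
    case True
    have "card T < card I" using insert by simp
    with insert.IH[of I A] insert.prems obtain c
      where "\<exists>i\<in>I. c i \<noteq> 0" "\<forall>t\<in>T. (\<Sum>i\<in>I. c i * A i t) = 0" by blast
    then show ?thesis using True by (intro exI[of _ c]) auto
  next
    case False
    then obtain i0 where i0: "i0 \<in> I" "A i0 t \<noteq> 0" by blast
    let ?J = "I - {i0}"
    have J: "finite ?J" "card T < card ?J" using insert i0 by auto
    from insert.IH[OF J, of "\<lambda>i u. A i u - A i t / A i0 t * A i0 u"] obtain c
      where c: "\<exists>i\<in>?J. c i \<noteq> 0"
        "\<And>u. u \<in> T \<Longrightarrow> (\<Sum>i\<in>?J. c i * (A i u - A i t / A i0 t * A i0 u)) = 0" by blast
    \<comment> \<open>The value at the pivot \<open>i0\<close> is forced by equation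
      \<open>t\<close>; the other unknowns solve the system from which \<open>i0\<close> has been
      eliminated.\<close>
    define c' where "c' i = (if i = i0 then - (\<Sum>i\<in>?J. c i * A i t) / A i0 t else c i)" for i
    have split: "(\<Sum>i\<in>I. c' i * A i u) = (\<Sum>i\<in>?J. c i * A i u) - (\<Sum>i\<in>?J. c i * A i t) / A i0 t * A i0 u" for u
    proof -
      have "(\<Sum>i\<in>I. c' i * A i u) = c' i0 * A i0 u + (\<Sum>i\<in>?J. c' i * A i u)"
        using i0 insert.prems by (subst sum.remove[of _ i0]) auto
      also have "(\<Sum>i\<in>?J. c' i * A i u) = (\<Sum>i\<in>?J. c i * A i u)"
        by (intro sum.cong) (auto simp: c'_def)
      finally show ?thesis by (simp add: c'_def)
    qed
    have "(\<Sum>i\<in>I. c' i * A i u) = 0" if "u \<in> insert t T" for u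
    proof (cases "u = t")
      case True
      then show ?thesis using i0 by (simp add: split)
    next
      case False
      then have "(\<Sum>i\<in>?J. c i * (A i u - A i t / A i0 t * A i0 u)) = 0" using c that by blast
      then show ?thesis unfolding split
        by (simp add: algebra_simps sum_subtractf sum_distrib_left sum_distrib_right sum_divide_distrib)
    qed
    moreover have "\<exists>i\<in>I. c' i \<noteq> 0" using c(1) by (auto simp: c'_def)
    ultimately show ?thesis by blast
  qed
qed

text \<open>\<open>D\<close> bounds the exponent of each variable separately, so for finite
  \<open>W\<close> at most (D + 1)^card W monomials can occur.\<close>

inductive_set deg_bounded :: "'v set \<Rightarrow> nat \<Rightarrow> (('v \<Rightarrow> 'a::field) \<Rightarrow> 'a) set" for W D where
  monom: "(\<And>v. v \<in> W \<Longrightarrow> e v \<le> D) \<Longrightarrow> (\<lambda>x. c * (\<Prod>v\<in>W. x v ^ e v)) \<in> deg_bounded W D"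
| add: "p \<in> deg_bounded W D \<Longrightarrow> q \<in> deg_bounded W D \<Longrightarrow> (\<lambda>x. p x + q x) \<in> deg_bounded W D"

lemma deg_bounded_const: "(\<lambda>x. c) \<in> deg_bounded W D"
  using deg_bounded.monom[of W "\<lambda>_. 0" D c] by simp

lemma deg_bounded_mono:
  assumes "p \<in> deg_bounded W D" "D \<le> D'" shows "p \<in> deg_bounded W D'"
  using assms(1) by induction (auto intro: deg_bounded.intros order_trans[OF _ assms(2)])

lemma deg_bounded_mult:
  assumes "p \<in> deg_bounded W D" "q \<in> deg_bounded W D'"
  shows "(\<lambda>x. p x * q x) \<in> deg_bounded W (D + D')"
  using assms(1)
proof induction
  case (monom e c)
  from assms(2) show ?case
  proof induction
    case (monom e' c')
    have "(\<lambda>x. (c * c') * (\<Prod>v\<in>W. x v ^ (e v + e' v))) \<in> deg_bounded W (D + D')"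
      using monom \<open>\<And>v. v \<in> W \<Longrightarrow> e v \<le> D\<close> by (intro deg_bounded.monom) (auto intro: add_mono)
    then show ?case by (simp add: power_add prod.distrib ac_simps)
  next
    case (add p q)
    from deg_bounded.add[OF add(3,4)] show ?case by (simp add: algebra_simps)
  qed
next
  case (add p q)
  from deg_bounded.add[OF add(3,4)] show ?case by (simp add: algebra_simps)
qed

lemma poly_fun_deg_bounded:
  fixes p :: "('v \<Rightarrow> 'a::field) \<Rightarrow> 'a"
  assumes "finite W" "p \<in> poly_fun W" shows "\<exists>D. p \<in> deg_bounded W D"
  using assms(2)
proof induction
  case (const c)
  show ?case using deg_bounded_const by blast
next
  case (var v)
  have "(\<lambda>x :: 'v \<Rightarrow> 'a. 1 * (\<Prod>u\<in>W. x u ^ of_bool (u = v))) \<in> deg_bounded W 1"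
    by (rule deg_bounded.monom) auto
  also have "(\<lambda>x :: 'v \<Rightarrow> 'a. 1 * (\<Prod>u\<in>W. x u ^ of_bool (u = v))) = (\<lambda>x. x v)"
  proof
    fix x :: "'v \<Rightarrow> 'a"
    have "(\<Prod>u\<in>W. x u ^ of_bool (u = v)) = (\<Prod>u\<in>W. if u = v then x u else 1)"
      by (intro prod.cong) auto
    then show "1 * (\<Prod>u\<in>W. x u ^ of_bool (u = v)) = x v" using var assms(1) by simp
  qed
  finally show ?case by blast
next
  case (add p q)
  then obtain D D' where "p \<in> deg_bounded W D" "q \<in> deg_bounded W D'" by blast
  then have "p \<in> deg_bounded W (max D D')" "q \<in> deg_bounded W (max D D')"
    by (auto intro: deg_bounded_mono)
  then show ?case using deg_bounded.add by blast
next
  case (mult p q)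
  then show ?case using deg_bounded_mult by blast
qed

lemma deg_bounded_power:
  assumes "p \<in> deg_bounded W D" shows "(\<lambda>x. p x ^ j) \<in> deg_bounded W (j * D)"
proof (induction j)
  case (Suc j)
  from deg_bounded_mult[OF assms this] show ?case by simp
qed (simp add: deg_bounded_const)

lemma exp_monom_deg_bounded:
  assumes "\<And>i. i < length a \<Longrightarrow> f i \<in> deg_bounded W D" "set a \<subseteq> {..N}"
  shows "exp_monom f a \<in> deg_bounded W (length a * (N * D))"
  using assms
proof (induction a)
  case Nil
  have "exp_monom f [] = (\<lambda>x. 1)" by auto
  then show ?case using deg_bounded_const by metis
next
  case (Cons j a)
  have "(\<lambda>x. f (length a) x ^ j) \<in> deg_bounded W (N * D)"
    by (rule deg_bounded_mono[OF deg_bounded_power]) (use Cons.prems in auto)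
  moreover have "exp_monom f a \<in> deg_bounded W (length a * (N * D))" using Cons by auto
  moreover have "exp_monom f (j # a) = (\<lambda>x. f (length a) x ^ j * exp_monom f a x)" by auto
  ultimately show ?case using deg_bounded_mult by fastforce
qed

text \<open>Extensional functions represent each exponent vector on \<open>W\<close> once; they will
  index the equations of a finite linear system.\<close>

lemma deg_bounded_expansion:
  assumes "finite W" "p \<in> deg_bounded W D"
  shows "\<exists>A. \<forall>x. p x = (\<Sum>e\<in>W \<rightarrow>\<^sub>E {..D}. A e * (\<Prod>v\<in>W. x v ^ e v))"
  using assms(2)
proof induction
  case (monom e c)
  let ?r = "restrict e W"
  have "?r \<in> W \<rightarrow>\<^sub>E {..D}" using monom by auto
  moreover have "finite (W \<rightarrow>\<^sub>E {..D})" using assms(1) by (intro finite_PiE) auto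
  ultimately have "(\<Sum>e'\<in>W \<rightarrow>\<^sub>E {..D}. (if e' = ?r then c else 0) * (\<Prod>v\<in>W. x v ^ e' v))
      = c * (\<Prod>v\<in>W. x v ^ ?r v)" for x :: "'a \<Rightarrow> 'b"
    by (subst sum.remove[of _ ?r]) (auto intro!: sum.neutral)
  then show ?case by (intro exI[of _ "\<lambda>e'. if e' = ?r then c else 0"]) simp
next
  case (add p q)
  then obtain A B where "\<forall>x. p x = (\<Sum>e\<in>W \<rightarrow>\<^sub>E {..D}. A e * (\<Prod>v\<in>W. x v ^ e v))"
    "\<forall>x. q x = (\<Sum>e\<in>W \<rightarrow>\<^sub>E {..D}. B e * (\<Prod>v\<in>W. x v ^ e v))" by blast
  then show ?case by (intro exI[of _ "\<lambda>e. A e + B e"]) (simp add: algebra_simps sum.distrib)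
qed

text \<open>There are (N + 1)^(card W + 1) monomials in the functions, but since degrees grow
  linearly in \<open>N\<close> their expansions involve only O(N^card W) monomials in the variables.
  For large \<open>N\<close> the coefficient equations are underdetermined.\<close>

lemma poly_fun_algebraically_dependent:
  fixes f :: "nat \<Rightarrow> ('w \<Rightarrow> 'a::field) \<Rightarrow> 'a"
  assumes W: "finite W" and l: "l = Suc (card W)" and f: "\<And>i. i < l \<Longrightarrow> f i \<in> poly_fun W"
  shows "\<exists>N c. (\<exists>a\<in>exponents l N. c a \<noteq> 0) \<and> (\<forall>w. (\<Sum>a\<in>exponents l N. c a * exp_monom f a w) = 0)"
proof -
  have "\<exists>D. \<forall>i<l'. f i \<in> deg_bounded W D" if "l' \<le> l" for l'
    using that
  proof (induction l')
    case (Suc l')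
    then obtain D where D: "\<forall>i<l'. f i \<in> deg_bounded W D" by auto
    have "f l' \<in> poly_fun W" using f Suc.prems by simp
    then obtain D' where "f l' \<in> deg_bounded W D'" using poly_fun_deg_bounded[OF W] by blast
    with D have "\<forall>i<Suc l'. f i \<in> deg_bounded W (max D D')"
      by (auto simp: less_Suc_eq intro: deg_bounded_mono)
    then show ?case by blast
  qed simp
  then obtain D where D: "\<And>i. i < l \<Longrightarrow> f i \<in> deg_bounded W D" by blast
  \<comment> \<open>With w = card W there are (M + 1)^w <= K^w (N + 1)^w equations; N = K^w turns
    this bound into N (N + 1)^w, which is below (N + 1)^(w + 1).\<close>
  define K where "K = Suc (l * D)"
  define N where "N = K ^ card W"
  define M where "M = l * (N * D)"
  have "exp_monom f a \<in> deg_bounded W M" if "a \<in> exponents l N" for a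
    using exp_monom_deg_bounded[of a f W D N] D that unfolding M_def exponents_def by auto
  then have "\<forall>a\<in>exponents l N. \<exists>A. \<forall>x. exp_monom f a x = (\<Sum>e\<in>W \<rightarrow>\<^sub>E {..M}. A e * (\<Prod>v\<in>W. x v ^ e v))"
    using deg_bounded_expansion[OF W] by blast
  then obtain A where A: "\<And>a x. a \<in> exponents l N \<Longrightarrow>
      exp_monom f a x = (\<Sum>e\<in>W \<rightarrow>\<^sub>E {..M}. A a e * (\<Prod>v\<in>W. x v ^ e v))" by metis
  have fin: "finite (W \<rightarrow>\<^sub>E {..M})" using W by (intro finite_PiE) auto
  have "card (W \<rightarrow>\<^sub>E {..M}) = Suc M ^ card W" using W by (simp add: card_PiE)
  also have "\<dots> \<le> (K * Suc N) ^ card W"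
    by (intro power_mono) (auto simp: M_def K_def algebra_simps)
  also have "\<dots> = N * Suc N ^ card W" by (simp only: N_def power_mult_distrib)
  also have "\<dots> < Suc N ^ l" by (simp add: l)
  finally have "card (W \<rightarrow>\<^sub>E {..M}) < card (exponents l N)" by (simp add: card_exponents)
  from underdetermined_system[OF fin finite_exponents this, of A] obtain c where
    c: "\<exists>a\<in>exponents l N. c a \<noteq> 0" "\<And>e. e \<in> W \<rightarrow>\<^sub>E {..M} \<Longrightarrow> (\<Sum>a\<in>exponents l N. c a * A a e) = 0"
    by blast
  have "(\<Sum>a\<in>exponents l N. c a * exp_monom f a w) = 0" for w
  proof -
    have "(\<Sum>a\<in>exponents l N. c a * exp_monom f a w)
        = (\<Sum>a\<in>exponents l N. \<Sum>e\<in>W \<rightarrow>\<^sub>E {..M}. c a * A a e * (\<Prod>v\<in>W. w v ^ e v))"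
      by (intro sum.cong refl) (simp add: A sum_distrib_left mult.assoc)
    also have "\<dots> = (\<Sum>e\<in>W \<rightarrow>\<^sub>E {..M}. (\<Sum>a\<in>exponents l N. c a * A a e) * (\<Prod>v\<in>W. w v ^ e v))"
      by (subst sum.swap) (simp add: sum_distrib_right)
    also have "\<dots> = 0" using c(2) by (intro sum.neutral) auto
    finally show ?thesis .
  qed
  with c(1) show ?thesis by blast
qed

text \<open>A relation among the pulled-back functions is a polynomial function vanishing on
  \<open>range \<psi>\<close>, hence on its closure and on the top member of the chain. This
  contradicts the independence of the functions that separate successive members.\<close>

lemma irr_chain_bound:
  fixes \<psi> :: "('w \<Rightarrow> 'a::field) \<Rightarrow> ('v \<Rightarrow> 'a)"
  assumes W: "finite W"
    and \<psi>: "\<And>v. v \<in> V \<Longrightarrow> (\<lambda>w. \<psi> w v) \<in> poly_fun W"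
    and Z: "Z \<subseteq> zariski_closure V (range \<psi>)"
  shows "\<not> irr_chain V Z (Suc (card W))"
proof
  define l where "l = Suc (card W)"
  assume "irr_chain V Z (Suc (card W))"
  then have "irr_chain V Z l" by (simp add: l_def)
  then obtain C where C: "\<And>i. i \<le> l \<Longrightarrow> zariski_irreducible V (C i)"
    "\<And>i. i < l \<Longrightarrow> C i \<subset> C (Suc i)" "C l \<subseteq> Z" unfolding irr_chain_def by blast
  have "\<exists>p\<in>poly_fun V. (\<forall>x\<in>C i. p x = 0) \<and> (\<exists>x\<in>C (Suc i). p x \<noteq> 0)" if i: "i < l" for i
  proof -
    have "zariski_closed V (C i)" using C(1)[of i] i unfolding zariski_irreducible_def by simp
    then obtain P where P: "P \<subseteq> poly_fun V" "C i = {x \<in> affine_space V. \<forall>p\<in>P. p x = 0}"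
      unfolding zariski_closed_def by blast
    obtain x where x: "x \<in> C (Suc i)" "x \<notin> C i" using C(2)[OF i] by blast
    moreover have "x \<in> affine_space V" using x zariski_irreducible_subset_affine[OF C(1)[of "Suc i"]] i by auto
    ultimately obtain p where "p \<in> P" "p x \<noteq> 0" using P by auto
    then show ?thesis using P x by blast
  qed
  then obtain f where f: "\<And>i. i < l \<Longrightarrow> f i \<in> poly_fun V"
    "\<And>i x. i < l \<Longrightarrow> x \<in> C i \<Longrightarrow> f i x = 0" "\<And>i. i < l \<Longrightarrow> \<exists>x\<in>C (Suc i). f i x \<noteq> 0"
    by metis
  obtain N c where c: "\<exists>a\<in>exponents l N. c a \<noteq> 0"
    "\<And>w. (\<Sum>a\<in>exponents l N. c a * exp_monom (\<lambda>i w. f i (\<psi> w)) a w) = 0"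
    using poly_fun_algebraically_dependent[OF W l_def, of "\<lambda>i w. f i (\<psi> w)"]
      poly_fun_comp[OF f(1) \<psi>] by auto
  have comp: "exp_monom (\<lambda>i w. f i (\<psi> w)) a w = exp_monom f a (\<psi> w)" for a w
    by (induction a) auto
  define p where "p x = (\<Sum>a\<in>exponents l N. c a * exp_monom f a x)" for x
  have "p \<in> poly_fun V"
    unfolding p_def
    by (intro poly_fun_sum poly_fun.mult poly_fun.const exp_monom_poly_fun f(1))
      (auto simp: exponents_def)
  moreover have "p (\<psi> w) = 0" for w using c(2)[of w] by (simp only: comp p_def)
  then have "\<forall>y\<in>range \<psi>. p y = 0" by blast
  ultimately have p0: "p x = 0" if "x \<in> C l" for x
    using that C(3) Z unfolding zariski_closure_def by blast
  have "c a = 0" if "a \<in> exponents l N" for a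
    using chain_algebraically_independent[OF C(1) psubset_imp_subset[OF C(2)] f p0[unfolded p_def] that]
    by blast
  with c(1) show False by blast
qed

section \<open>Determinants and Smith form\<close>

lemma index_mult_mat_sum:
  assumes "A \<in> carrier_mat m n" "B \<in> carrier_mat n q" "i < m" "j < q"
  shows "(A * B) $$ (i, j) = (\<Sum>k<n. A $$ (i, k) * B $$ (k, j))"
  using assms by (auto simp: scalar_prod_def atLeast0LessThan intro!: sum.cong)

text \<open>A repeated index gives two equal rows and determinant 0; otherwise \<open>f\<close> is
  an increasing selection composed with a permutation, which only affects the sign. The matrix is
  transposed because it arises from an expansion that is linear in rows.\<close>

lemma minor_dvd_of_strict_mono:
  fixes M :: "'a::comm_ring_1 mat"
  assumes M: "M \<in> carrier_mat m n" and f: "\<And>i. i < m \<Longrightarrow> f i < n"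
    and minors: "\<And>\<gamma>. strict_mono_on {..<m} \<gamma> \<Longrightarrow> (\<And>b. b < m \<Longrightarrow> \<gamma> b < n) \<Longrightarrow>
      d dvd det (mat m m (\<lambda>(a, b). M $$ (a, \<gamma> b)))"
  shows "d dvd det (mat m m (\<lambda>(i, j). M $$ (j, f i)))"
proof (cases "inj_on f {0..<m}")
  case False
  then obtain i j where ij: "i < m" "j < m" "i \<noteq> j" "f i = f j" unfolding inj_on_def by auto
  let ?A = "mat m m (\<lambda>(i, j). M $$ (j, f i))"
  have "row ?A i = row ?A j" using ij by (intro eq_vecI) auto
  then have "det ?A = 0" using ij by (intro det_identical_rows[of ?A m i j]) auto
  then show ?thesis by simp
next
  case True
  define xs where "xs = sorted_list_of_set (f ` {0..<m})"
  have len: "length xs = m" unfolding xs_def by (simp add: card_image[OF True])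
  have set: "set xs = f ` {0..<m}" unfolding xs_def by simp
  have mono: "strict_mono_on {..<m} ((!) xs)"
    unfolding strict_mono_on_def xs_def
    using strict_sorted_list_of_set[of "f ` {0..<m}"] len
    by (auto simp: sorted_wrt_iff_nth_less xs_def[symmetric])
  have xsn: "xs ! b < n" if "b < m" for b
    using that set len f nth_mem[of b xs] by auto
  have "\<exists>k<m. xs ! k = f i" if "i < m" for i
    using that set len by (metis atLeastLessThan_iff image_eqI in_set_conv_nth le0)
  then obtain \<pi>0 where \<pi>0: "\<And>i. i < m \<Longrightarrow> \<pi>0 i < m \<and> xs ! \<pi>0 i = f i" by metis
  define \<pi> where "\<pi> i = (if i < m then \<pi>0 i else i)" for i
  have "inj_on \<pi> {0..<m}"
  proof (rule inj_onI)
    fix i j assume ij: "i \<in> {0..<m}" "j \<in> {0..<m}" "\<pi> i = \<pi> j"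
    then have "f i = f j" using \<pi>0[of i] \<pi>0[of j] by (auto simp: \<pi>_def)
    then show "i = j" using True ij by (auto dest: inj_onD)
  qed
  moreover have "\<pi> \<in> {0..<m} \<rightarrow> {0..<m}" using \<pi>0 by (auto simp: \<pi>_def)
  moreover have "\<forall>i. i \<notin> {0..<m} \<longrightarrow> \<pi> i = i" by (auto simp: \<pi>_def)
  ultimately have perm: "\<pi> permutes {0..<m}" by (intro inj_on_nat_permutes) auto
  let ?A = "mat m m (\<lambda>(i, j). M $$ (j, xs ! i))"
  have "mat m m (\<lambda>(i, j). M $$ (j, f i)) = mat m m (\<lambda>(i, j). ?A $$ (\<pi> i, j))"
    using \<pi>0 by (intro eq_matI) (auto simp: \<pi>_def)
  then have "det (mat m m (\<lambda>(i, j). M $$ (j, f i))) = signof \<pi> * det ?A"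
    using det_permute_rows[of ?A m, OF _ perm] by simp
  also have "det ?A = det (transpose_mat ?A)" using det_transpose[of ?A m] by simp
  also have "transpose_mat ?A = mat m m (\<lambda>(a, b). M $$ (a, xs ! b))"
    by (intro eq_matI) auto
  finally show ?thesis using minors[OF mono xsn] by simp
qed

text \<open>The divisibility part of the Cauchy-Binet formula: by multilinearity the determinant is
  a combination of determinants formed from columns of \<open>M\<close>, with products of entries of
  \<open>Q\<close> as coefficients.\<close>

lemma det_mult_dvd_of_minors:
  fixes M :: "'a::comm_ring_1 mat"
  assumes M: "M \<in> carrier_mat m n" and Q: "Q \<in> carrier_mat n m"
    and minors: "\<And>\<gamma>. strict_mono_on {..<m} \<gamma> \<Longrightarrow> (\<And>b. b < m \<Longrightarrow> \<gamma> b < n) \<Longrightarrow>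
      d dvd det (mat m m (\<lambda>(a, b). M $$ (a, \<gamma> b)))"
  shows "d dvd det (M * Q)"
proof -
  \<comment> \<open>Column i of M * Q, a row of the transpose, is the sum over j of Q_ji times
    column j of M.\<close>
  define a where "a i j = Q $$ (j, i) \<cdot>\<^sub>v col M j" for i j
  have a: "a \<in> {0..<m} \<rightarrow> {0..<n} \<rightarrow> carrier_vec m" using M by (auto simp: a_def)
  have "transpose_mat (M * Q) = mat\<^sub>r m m (\<lambda>i. finsum_vec TYPE('a) m (a i) {0..<n})"
  proof (rule eq_matI)
    fix i j assume "i < dim_row (mat\<^sub>r m m (\<lambda>i. finsum_vec TYPE('a) m (a i) {0..<n}))"
      "j < dim_col (mat\<^sub>r m m (\<lambda>i. finsum_vec TYPE('a) m (a i) {0..<n}))"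
    then have ij: "i < m" "j < m" by auto
    have "finsum_vec TYPE('a) m (a i) {0..<n} $ j = (\<Sum>k\<in>{0..<n}. a i k $ j)"
      using a ij by (intro index_finsum_vec) auto
    also have "\<dots> = (\<Sum>k<n. M $$ (j, k) * Q $$ (k, i))"
      using ij M by (auto simp: a_def atLeast0LessThan mult.commute intro!: sum.cong)
    finally show "transpose_mat (M * Q) $$ (i, j)
        = mat\<^sub>r m m (\<lambda>i. finsum_vec TYPE('a) m (a i) {0..<n}) $$ (i, j)"
      using ij index_mult_mat_sum[OF M Q ij(2) ij(1)] M Q by simp
  qed (use M Q in auto)
  then have "det (M * Q) = det (mat\<^sub>r m m (\<lambda>i. finsum_vec TYPE('a) m (a i) {0..<n}))"
    using det_transpose[of "M * Q" m] M Q by auto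
  also have "\<dots> = (\<Sum>f | (\<forall>i\<in>{0..<m}. f i \<in> {0..<n}) \<and> (\<forall>i. i \<notin> {0..<m} \<longrightarrow> f i = i).
      det (mat\<^sub>r m m (\<lambda>i. a i (f i))))"
    by (rule det_linear_rows_sum[OF _ a]) simp
  also have "d dvd \<dots>"
  proof (rule dvd_sum)
    fix f assume "f \<in> {f. (\<forall>i\<in>{0..<m}. f i \<in> {0..<n}) \<and> (\<forall>i. i \<notin> {0..<m} \<longrightarrow> f i = i)}"
    then have f: "f i < n" if "i < m" for i using that by auto
    have "det (mat\<^sub>r m m (\<lambda>i. a i (f i))) = (\<Prod>i\<in>{0..<m}. Q $$ (f i, i)) * det (mat\<^sub>r m m (\<lambda>i. col M (f i)))"
      unfolding a_def using M by (intro det_rows_mul) auto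
    moreover have "mat\<^sub>r m m (\<lambda>i. col M (f i)) = mat m m (\<lambda>(i, j). M $$ (j, f i))"
      using M f by (intro eq_matI) auto
    moreover have "d dvd det (mat m m (\<lambda>(i, j). M $$ (j, f i)))"
      by (rule minor_dvd_of_strict_mono[OF M f minors])
    ultimately show "d dvd det (mat\<^sub>r m m (\<lambda>i. a i (f i)))" by simp
  qed
  finally show ?thesis .
qed

text \<open>Cramer's rule modulo \<open>d\<close>: multiplying the row v * M by the adjugate of
  \<open>M\<close> gives det M * v, and divisibility of the entries by \<open>d\<close>
  persists.\<close>

lemma left_kernel_dvd_det:
  fixes M :: "'a::comm_ring_1 mat"
  assumes M: "M \<in> carrier_mat m m" and i: "i < m"
    and ker: "\<And>j. j < m \<Longrightarrow> d dvd (\<Sum>i<m. v i * M $$ (i, j))"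
  shows "d dvd v i * det M"
proof -
  note adj = adj_mat[OF M]
  have "(\<Sum>j<m. (\<Sum>i'<m. v i' * M $$ (i', j)) * adj_mat M $$ (j, i))
      = (\<Sum>i'<m. v i' * (\<Sum>j<m. M $$ (i', j) * adj_mat M $$ (j, i)))"
    by (simp add: sum_distrib_left sum_distrib_right mult.assoc) (rule sum.swap)
  also have "\<dots> = (\<Sum>i'<m. v i' * (if i' = i then det M else 0))"
  proof (intro sum.cong refl arg_cong2[where f = "(*)"])
    fix i' assume "i' \<in> {..<m}"
    then show "(\<Sum>j<m. M $$ (i', j) * adj_mat M $$ (j, i)) = (if i' = i then det M else 0)"
      using index_mult_mat_sum[OF M adj(1), of i' i] i unfolding adj(2) by auto
  qed
  also have "\<dots> = v i * det M" using i by (simp add: if_distrib cong: if_cong)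
  finally have eq: "v i * det M = (\<Sum>j<m. (\<Sum>i'<m. v i' * M $$ (i', j)) * adj_mat M $$ (j, i))" ..
  show ?thesis unfolding eq by (rule dvd_sum, rule dvd_mult2, rule ker) simp
qed

lemma det_unit_inverse:
  fixes P :: "'a::comm_ring_1 mat"
  assumes P: "P \<in> carrier_mat m m" and unit: "det P dvd 1"
  shows "\<exists>P'\<in>carrier_mat m m. P * P' = 1\<^sub>m m \<and> P' * P = 1\<^sub>m m"
proof -
  obtain u where u: "1 = det P * u" using unit by (elim dvdE)
  note adj = adj_mat[OF P]
  have "P * (u \<cdot>\<^sub>m adj_mat P) = u \<cdot>\<^sub>m (det P \<cdot>\<^sub>m 1\<^sub>m m)"
    using mult_smult_distrib[OF P adj(1)] adj(2) by simp
  moreover have "(u \<cdot>\<^sub>m adj_mat P) * P = u \<cdot>\<^sub>m (det P \<cdot>\<^sub>m 1\<^sub>m m)"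
    using mult_smult_assoc_mat[OF adj(1) P] adj(3) by simp
  moreover have "u \<cdot>\<^sub>m (det P \<cdot>\<^sub>m 1\<^sub>m m) = 1\<^sub>m m"
    using u by (intro eq_matI) (auto simp: mult.commute)
  ultimately show ?thesis using adj(1) by (intro bexI[of _ "u \<cdot>\<^sub>m adj_mat P"]) auto
qed

section \<open>Diagonalisation when divisibility is total\<close>

lemma finite_common_divisor:
  fixes S :: "'r::comm_ring_1 set"
  assumes "\<And>x y :: 'r. x dvd y \<or> y dvd x" "finite S" "S \<noteq> {}"
  shows "\<exists>x\<in>S. \<forall>y\<in>S. x dvd y"
  using assms(2,3)
proof (induction rule: finite_ne_induct)
  case (insert x S)
  then obtain y where "y \<in> S" "\<forall>z\<in>S. y dvd z" by blast
  then show ?case using assms(1)[of x y] by (auto intro: dvd_trans)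
qed auto

text \<open>Invertibility is encoded as a unit determinant: this is multiplicative, easily checked
  for swap and unitriangular matrices, and \<open>det_unit_inverse\<close> recovers the
  inverses.\<close>

definition mat_equivalent :: "nat \<Rightarrow> nat \<Rightarrow> 'a::comm_ring_1 mat \<Rightarrow> 'a mat \<Rightarrow> bool" where
  "mat_equivalent m n A B \<longleftrightarrow> (\<exists>P\<in>carrier_mat m m. \<exists>Q\<in>carrier_mat n n.
     det P dvd 1 \<and> det Q dvd 1 \<and> B = P * A * Q)"

lemma mat_equivalent_refl: "A \<in> carrier_mat m n \<Longrightarrow> mat_equivalent m n A A"
  unfolding mat_equivalent_def
  by (intro bexI[of _ "1\<^sub>m m"] bexI[of _ "1\<^sub>m n"]) auto

lemma mat_equivalent_trans:
  assumes A: "A \<in> carrier_mat m n" and "mat_equivalent m n A B" "mat_equivalent m n B C"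
  shows "mat_equivalent m n A C"
proof -
  from assms obtain P Q P' Q' where c: "P \<in> carrier_mat m m" "Q \<in> carrier_mat n n"
    "P' \<in> carrier_mat m m" "Q' \<in> carrier_mat n n" and u: "det P dvd 1" "det Q dvd 1" "det P' dvd 1" "det Q' dvd 1"
    and eq: "B = P * A * Q" "C = P' * B * Q'"
    unfolding mat_equivalent_def by auto
  have "P' * (P * A * Q) = P' * P * A * Q"
    using c A by (simp add: assoc_mult_mat[of _ m m _ m _ n] assoc_mult_mat[of _ m m _ n _ n]
      assoc_mult_mat[of _ m n _ n _ n])
  then have "C = P' * P * A * (Q * Q')"
    unfolding eq using c A by (simp add: assoc_mult_mat[of _ m n Q n Q' n])
  moreover have "det (P' * P) dvd 1" "det (Q * Q') dvd 1"
    using u c by (auto simp: det_mult[of _ m] det_mult[of _ n])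
  ultimately show ?thesis unfolding mat_equivalent_def using c
    by (intro bexI[of _ "P' * P"] bexI[of _ "Q * Q'"]) auto
qed

text \<open>A swap matrix is its own inverse, so its determinant squares to 1.\<close>

lemma swaprows_mat_det_unit: "k < n \<Longrightarrow> l < n \<Longrightarrow> det (swaprows_mat n k l :: 'a::comm_ring_1 mat) dvd 1"
  using arg_cong[OF swaprows_mat_inv[of k n l], of det]
  by (auto simp: det_mult[of _ n] dvd_def)

lemma mat_equivalent_swap:
  assumes A: "A \<in> carrier_mat m n" and "k < m" "k' < m" "l < n" "l' < n"
  shows "mat_equivalent m n A (swapcols l l' (swaprows k k' A))"
proof -
  have "swaprows k k' A = swaprows_mat m k k' * A" using assms by (intro swaprows_mat) auto
  moreover have "swapcols l l' (swaprows k k' A) = swaprows k k' A * swaprows_mat n l l'"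
    using assms by (intro swapcols_mat[of _ m]) auto
  ultimately show ?thesis unfolding mat_equivalent_def
    using assms swaprows_mat_det_unit
    by (intro bexI[of _ "swaprows_mat m k k'"] bexI[of _ "swaprows_mat n l l'"]) auto
qed

text \<open>The inner \<open>B\<close> is the result of the row operations, and the column
  operations act on \<open>B\<close>. With the quotients by the pivot as multipliers, row and column
  \<open>r\<close> are cleared beyond the pivot. Both transformation matrices are
  unitriangular.\<close>

lemma mat_equivalent_eliminate:
  fixes A :: "'a::comm_ring_1 mat"
  assumes A: "A \<in> carrier_mat m n" and r: "r < m" "r < n"
  shows "mat_equivalent m n A (mat m n (\<lambda>(i, j).
    let B = (\<lambda>i j. A $$ (i, j) - of_bool (r < i) * q i * A $$ (r, j))
    in B i j - of_bool (r < j) * q' j * B i r))"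
proof -
  define B where "B i j = A $$ (i, j) - of_bool (r < i) * q i * A $$ (r, j)" for i j
  define P where "P = mat m m (\<lambda>(i, j). of_bool (i = j) - of_bool (j = r) * (of_bool (r < i) * q i))"
  define Q where "Q = mat n n (\<lambda>(i, j). of_bool (i = j) - of_bool (i = r) * (of_bool (r < j) * q' j))"
  have P: "P \<in> carrier_mat m m" and Q: "Q \<in> carrier_mat n n" by (auto simp: P_def Q_def)
  have PA: "(P * A) $$ (i, j) = B i j" if "i < m" "j < n" for i j
  proof -
    have "(P * A) $$ (i, j) = (\<Sum>k<m. P $$ (i, k) * A $$ (k, j))"
      by (rule index_mult_mat_sum[OF P A that])
    also have "\<dots> = (\<Sum>k<m. (if k = i then A $$ (k, j) else 0)
        - (if k = r then of_bool (r < i) * q i * A $$ (k, j) else 0))"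
      using that by (intro sum.cong) (auto simp: P_def algebra_simps)
    also have "\<dots> = B i j" using that r by (simp add: sum_subtractf B_def)
    finally show ?thesis .
  qed
  have PAQ: "(P * A * Q) $$ (i, j) = B i j - of_bool (r < j) * q' j * B i r" if "i < m" "j < n" for i j
  proof -
    have "P * A \<in> carrier_mat m n" using P A by simp
    then have "(P * A * Q) $$ (i, j) = (\<Sum>k<n. (P * A) $$ (i, k) * Q $$ (k, j))"
      by (rule index_mult_mat_sum[OF _ Q that])
    also have "\<dots> = (\<Sum>k<n. (if k = j then B i k else 0)
        - (if k = r then of_bool (r < j) * q' j * B i k else 0))"
      using that by (intro sum.cong) (auto simp: Q_def PA algebra_simps)
    also have "\<dots> = B i j - of_bool (r < j) * q' j * B i r"
      using that r by (simp add: sum_subtractf)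
    finally show ?thesis .
  qed
  have "det P = prod_list (diag_mat P)"
    by (rule det_lower_triangular[OF _ P]) (auto simp: P_def)
  also have "\<dots> = 1" unfolding prod_list_diag_prod by (rule prod.neutral) (auto simp: P_def)
  finally have "det P dvd 1" by simp
  have "det Q = prod_list (diag_mat Q)"
    by (rule det_upper_triangular[OF _ Q]) (auto simp: Q_def upper_triangular_def)
  also have "\<dots> = 1" unfolding prod_list_diag_prod by (rule prod.neutral) (auto simp: Q_def)
  finally have "det Q dvd 1" by simp
  moreover have "mat m n (\<lambda>(i, j).
    let B = (\<lambda>i j. A $$ (i, j) - of_bool (r < i) * q i * A $$ (r, j))
    in B i j - of_bool (r < j) * q' j * B i r) = P * A * Q"
    using PAQ P A Q by (intro eq_matI) (auto simp: B_def Let_def)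
  ultimately show ?thesis
    unfolding mat_equivalent_def using P Q \<open>det P dvd 1\<close> by blast
qed

text \<open>Since divisibility is total, some entry of the remaining block divides all the others and can
  serve as a pivot.\<close>

lemma mat_equivalent_diagonal:
  fixes A :: "'a::comm_ring_1 mat"
  assumes total: "\<And>x y :: 'a. x dvd y \<or> y dvd x" and A: "A \<in> carrier_mat m n" and mn: "m \<le> n"
    and "r \<le> m"
  shows "\<exists>B\<in>carrier_mat m n. mat_equivalent m n A B \<and>
    (\<forall>i<m. \<forall>j<n. i \<noteq> j \<longrightarrow> i < r \<or> j < r \<longrightarrow> B $$ (i, j) = 0)"
  using \<open>r \<le> m\<close>
proof (induction r)
  case 0
  then show ?case using A mat_equivalent_refl by auto
next
  case (Suc r)
  then obtain B where B: "B \<in> carrier_mat m n" "mat_equivalent m n A B"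
    and B0: "\<And>i j. i < m \<Longrightarrow> j < n \<Longrightarrow> i \<noteq> j \<Longrightarrow> i < r \<or> j < r \<Longrightarrow> B $$ (i, j) = 0" by auto
  have r: "r < m" "r < n" using Suc.prems mn by auto
  let ?S = "(\<lambda>(i, j). B $$ (i, j)) ` ({r..<m} \<times> {r..<n})"
  have "?S \<noteq> {}" using r by auto
  then obtain x where "x \<in> ?S" "\<forall>y\<in>?S. x dvd y" using finite_common_divisor[OF total, of ?S] by auto
  then obtain i0 j0 where ij0: "r \<le> i0" "i0 < m" "r \<le> j0" "j0 < n"
    and dvd: "\<And>i j. r \<le> i \<Longrightarrow> i < m \<Longrightarrow> r \<le> j \<Longrightarrow> j < n \<Longrightarrow> B $$ (i0, j0) dvd B $$ (i, j)"
    by auto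
  define C where "C = swapcols r j0 (swaprows r i0 B)"
  have C: "C \<in> carrier_mat m n" using B(1) by (auto simp: C_def)
  have BC: "mat_equivalent m n B C"
    unfolding C_def by (rule mat_equivalent_swap) (use B(1) r ij0 in auto)
  \<comment> \<open>Both swaps move only indices at least \<open>r\<close>, so the zeros already
    obtained survive.\<close>
  have C0: "C $$ (i, j) = 0" if "i < m" "j < n" "i \<noteq> j" "i < r \<or> j < r" for i j
    using that B(1) B0 r ij0 by (auto simp: C_def)
  have "C $$ (r, r) = B $$ (i0, j0)" using B(1) r ij0 by (auto simp: C_def)
  then have "C $$ (r, r) dvd C $$ (i, j)" if "r \<le> i" "i < m" "r \<le> j" "j < n" for i j
    using that B(1) r ij0 dvd by (auto simp: C_def)
  then have "\<forall>i. \<exists>q. r < i \<longrightarrow> i < m \<longrightarrow> C $$ (i, r) = C $$ (r, r) * q"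
    "\<forall>j. \<exists>q. r < j \<longrightarrow> j < n \<longrightarrow> C $$ (r, j) = C $$ (r, r) * q"
    using r by (meson dvdE less_imp_le order_refl)+
  then obtain q q' where q: "\<And>i. r < i \<Longrightarrow> i < m \<Longrightarrow> C $$ (i, r) = C $$ (r, r) * q i"
    and q': "\<And>j. r < j \<Longrightarrow> j < n \<Longrightarrow> C $$ (r, j) = C $$ (r, r) * q' j" by metis
  define D where "D = mat m n (\<lambda>(i, j).
    let B = (\<lambda>i j. C $$ (i, j) - of_bool (r < i) * q i * C $$ (r, j))
    in B i j - of_bool (r < j) * q' j * B i r)"
  have CD: "mat_equivalent m n C D" unfolding D_def by (rule mat_equivalent_eliminate[OF C r])
  have "D $$ (i, j) = 0" if ij: "i < m" "j < n" "i \<noteq> j" "i < Suc r \<or> j < Suc r" for i j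
  proof -
    consider "i < r" | "i = r" | "r < i" "j < r" | "r < i" "j = r" using ij by linarith
    then show ?thesis
    proof cases
      case 1
      then show ?thesis using ij r C0[of i j] C0[of i r] by (simp add: D_def)
    next
      case 2
      then show ?thesis using ij r C0[of i j] q'[of j] by (cases "r < j") (auto simp: D_def mult.commute)
    next
      case 3
      then show ?thesis using ij r C0[of i j] C0[of r j] by (simp add: D_def)
    next
      case 4
      then show ?thesis using ij r q[of i] by (simp add: D_def mult.commute)
    qed
  qed
  moreover have "mat_equivalent m n A D"
    using mat_equivalent_trans[OF A mat_equivalent_trans[OF A B(2) BC] CD] .
  moreover have "D \<in> carrier_mat m n" by (simp add: D_def)
  ultimately show ?case by blast
qed

section \<open>Jets of matrices\<close>

lemma fps_X_power_dvd_iff: "fps_X ^ k dvd (f :: 'a::field fps) \<longleftrightarrow> (\<forall>l<k. fps_nth f l = 0)"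
proof
  assume "fps_X ^ k dvd f"
  then obtain g where "f = fps_X ^ k * g" by (elim dvdE)
  then show "\<forall>l<k. fps_nth f l = 0" by (simp add: fps_X_power_mult_nth)
next
  assume *: "\<forall>l<k. fps_nth f l = 0"
  have "f = fps_X ^ k * fps_shift k f"
    by (rule fps_ext) (use * in \<open>auto simp: fps_X_power_mult_nth\<close>)
  then show "fps_X ^ k dvd f" by (rule dvdI)
qed

lemma fps_X_power_dvd_fps_of_poly_iff:
  "fps_X ^ k dvd fps_of_poly (q :: 'a::field poly) \<longleftrightarrow> (\<forall>l<k. coeff q l = 0)"
  by (simp add: fps_X_power_dvd_iff)

text \<open>F[[t]] is a valuation ring: divisibility compares orders of vanishing at t = 0. This
  supplies the pivots.\<close>

lemma fps_dvd_total: "(f :: 'a::field fps) dvd g \<or> g dvd f"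
  by (cases "f = 0"; cases "g = 0") (auto simp: fps_dvd_iff)

definition jet_mat :: "nat \<Rightarrow> nat \<Rightarrow> nat \<Rightarrow> (nat \<times> nat \<times> nat \<Rightarrow> 'a::field) \<Rightarrow> 'a fps mat" where
  "jet_mat m n k x = mat m n (\<lambda>(i, j). fps_of_poly (jet_entry k x i j))"

text \<open>Truncates power series to jets. The value 0 outside the index range is what membership
  in \<open>affine_space\<close> demands.\<close>

definition jet_of :: "nat \<Rightarrow> nat \<Rightarrow> nat \<Rightarrow> 'a::field fps mat \<Rightarrow> nat \<times> nat \<times> nat \<Rightarrow> 'a" where
  "jet_of m n k X = (\<lambda>(i, j, l). if i < m \<and> j < n \<and> l < k then fps_nth (X $$ (i, j)) l else 0)"

lemma coeff_jet_entry: "coeff (jet_entry k x i j) l = (if l < k then x (i, j, l) else 0)"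
  by (simp add: jet_entry_def coeff_sum)

lemma jet_mat_carrier: "jet_mat m n k x \<in> carrier_mat m n"
  by (simp add: jet_mat_def)

lemma jet_mat_nth:
  "i < m \<Longrightarrow> j < n \<Longrightarrow> fps_nth (jet_mat m n k x $$ (i, j)) l = (if l < k then x (i, j, l) else 0)"
  by (simp add: jet_mat_def coeff_jet_entry)

lemma jet_of_jet_mat: "x \<in> affine_space (jet_vars m n k) \<Longrightarrow> jet_of m n k (jet_mat m n k x) = x"
  by (auto simp: jet_of_def jet_mat_nth affine_space_def jet_vars_def fun_eq_iff)

lemma fps_of_poly_jet_minor:
  "fps_of_poly (jet_minor r k x \<rho> \<gamma>) = det (mat r r (\<lambda>(a, b). fps_of_poly (jet_entry k x (\<rho> a) (\<gamma> b))))"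
proof -
  interpret h: comm_ring_hom "fps_of_poly :: 'a poly \<Rightarrow> 'a fps"
    by unfold_locales (auto simp: fps_of_poly_add fps_of_poly_mult)
  have "map_mat fps_of_poly (mat r r (\<lambda>(a, b). jet_entry k x (\<rho> a) (\<gamma> b)))
      = mat r r (\<lambda>(a, b). fps_of_poly (jet_entry k x (\<rho> a) (\<gamma> b)))"
    by (intro eq_matI) auto
  then show ?thesis unfolding jet_minor_def h.hom_det[symmetric] by simp
qed

text \<open>Leaves the identity as the only row selection for maximal minors. Values grow by at
  least 1 per step: counting up from 0 gives one inequality, counting from \<open>a\<close> to m - 1
  the other.\<close>

lemma strict_mono_on_lessThan_self:
  fixes \<rho> :: "nat \<Rightarrow> nat"
  assumes mono: "strict_mono_on {..<m} \<rho>" and lt: "\<And>a. a < m \<Longrightarrow> \<rho> a < m" and a: "a < m"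
  shows "\<rho> a = a"
proof (rule antisym)
  have step: "\<rho> b < \<rho> (Suc b)" if "Suc b < m" for b
    using strict_mono_onD[OF mono, of b "Suc b"] that by simp
  show "a \<le> \<rho> a" using a
  proof (induction a)
    case (Suc a)
    then show ?case using step[of a] by simp
  qed simp
  have "\<rho> a + d \<le> \<rho> (a + d)" if "a + d < m" for d
    using that
  proof (induction d)
    case (Suc d)
    then show ?case using step[of "a + d"] by simp
  qed simp
  from this[of "m - 1 - a"] show "\<rho> a \<le> a" using a lt[of "m - 1"] by simp
qed

lemma mem_jet_det_variety_iff:
  "x \<in> jet_det_variety m n m k \<longleftrightarrow> x \<in> affine_space (jet_vars m n k) \<and>
    (\<forall>\<gamma>. strict_mono_on {..<m} \<gamma> \<longrightarrow> (\<forall>b<m. \<gamma> b < n) \<longrightarrow>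
      fps_X ^ k dvd det (mat m m (\<lambda>(a, b). jet_mat m n k x $$ (a, \<gamma> b))))"
proof -
  have eq: "(\<forall>l<k. coeff (jet_minor m k x \<rho> \<gamma>) l = 0) \<longleftrightarrow>
      fps_X ^ k dvd det (mat m m (\<lambda>(a, b). jet_mat m n k x $$ (a, \<gamma> b)))"
    if \<rho>: "strict_mono_on {..<m} \<rho>" "\<forall>a<m. \<rho> a < m" and \<gamma>: "\<forall>b<m. \<gamma> b < n" for \<rho> \<gamma>
  proof -
    have "mat m m (\<lambda>(a, b). fps_of_poly (jet_entry k x (\<rho> a) (\<gamma> b)))
        = mat m m (\<lambda>(a, b). jet_mat m n k x $$ (a, \<gamma> b))"
      using \<gamma> strict_mono_on_lessThan_self[OF \<rho>(1)] \<rho>(2) by (intro eq_matI) (auto simp: jet_mat_def)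
    then have "det (mat m m (\<lambda>(a, b). jet_mat m n k x $$ (a, \<gamma> b))) = fps_of_poly (jet_minor m k x \<rho> \<gamma>)"
      by (simp add: fps_of_poly_jet_minor)
    then show ?thesis by (simp only: fps_X_power_dvd_fps_of_poly_iff)
  qed
  have id: "strict_mono_on {..<m} (\<lambda>a. a :: nat)" "\<forall>a<m. a < m" by (auto simp: strict_mono_on_def)
  show ?thesis
  proof
    assume x: "x \<in> jet_det_variety m n m k"
    have "fps_X ^ k dvd det (mat m m (\<lambda>(a, b). jet_mat m n k x $$ (a, \<gamma> b)))"
      if "strict_mono_on {..<m} \<gamma>" "\<forall>b<m. \<gamma> b < n" for \<gamma>
      using x id that unfolding jet_det_variety_def eq[OF id that(2), symmetric] by simp
    then show "x \<in> affine_space (jet_vars m n k) \<and> (\<forall>\<gamma>. strict_mono_on {..<m} \<gamma> \<longrightarrow> (\<forall>b<m. \<gamma> b < n) \<longrightarrow>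
      fps_X ^ k dvd det (mat m m (\<lambda>(a, b). jet_mat m n k x $$ (a, \<gamma> b))))"
      using x unfolding jet_det_variety_def by simp
  next
    assume x: "x \<in> affine_space (jet_vars m n k) \<and> (\<forall>\<gamma>. strict_mono_on {..<m} \<gamma> \<longrightarrow> (\<forall>b<m. \<gamma> b < n) \<longrightarrow>
      fps_X ^ k dvd det (mat m m (\<lambda>(a, b). jet_mat m n k x $$ (a, \<gamma> b))))"
    then show "x \<in> jet_det_variety m n m k"
      unfolding jet_det_variety_def by (simp add: eq)
  qed
qed

section \<open>Coefficients of minors as polynomial functions\<close>

lemma coeff_mult_poly_fun:
  assumes "\<And>l. (\<lambda>x. coeff (f x) l) \<in> poly_fun V" "\<And>l. (\<lambda>x. coeff (g x) l) \<in> poly_fun V"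
  shows "(\<lambda>x. coeff (f x * g x) l) \<in> poly_fun V"
  unfolding coeff_mult by (intro poly_fun_sum poly_fun.mult assms)

lemma coeff_prod_poly_fun:
  assumes "\<And>i l. i \<in> I \<Longrightarrow> (\<lambda>x. coeff (f i x) l) \<in> poly_fun V"
  shows "(\<lambda>x. coeff (\<Prod>i\<in>I. f i x) l) \<in> poly_fun V"
  using assms
proof (induction I arbitrary: l rule: infinite_finite_induct)
  case (insert i I)
  have "(\<lambda>x. coeff (f i x * (\<Prod>i\<in>I. f i x)) l) \<in> poly_fun V"
    by (rule coeff_mult_poly_fun) (use insert in auto)
  then show ?case using insert.hyps by simp
qed (simp_all add: poly_fun.const)

lemma coeff_jet_minor_poly_fun:
  assumes "\<And>a. a < r \<Longrightarrow> \<rho> a < m" "\<And>b. b < r \<Longrightarrow> \<gamma> b < n"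
  shows "(\<lambda>x. coeff (jet_minor r k x \<rho> \<gamma>) l) \<in> poly_fun (jet_vars m n k)"
proof -
  have entry: "(\<lambda>x. coeff (jet_entry k x (\<rho> a) (\<gamma> b)) l) \<in> poly_fun (jet_vars m n k)"
    if "a < r" "b < r" for a b l
    using that assms unfolding coeff_jet_entry
    by (cases "l < k") (auto intro!: poly_fun.const poly_fun.var simp: jet_vars_def)
  have perm: "\<pi> i < r" if "\<pi> permutes {0..<r}" "i < r" for \<pi> i
    using permutes_in_image[OF that(1), of i] that(2) by simp
  have "jet_minor r k x \<rho> \<gamma> = (\<Sum>\<pi> | \<pi> permutes {0..<r}.
      signof \<pi> * (\<Prod>i = 0..<r. jet_entry k x (\<rho> i) (\<gamma> (\<pi> i))))" for x :: "nat \<times> nat \<times> nat \<Rightarrow> 'a"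
    unfolding jet_minor_def by (subst det_def'[of _ r]) (auto simp: perm intro!: sum.cong prod.cong)
  then have eq: "(\<lambda>x. coeff (jet_minor r k x \<rho> \<gamma>) l) = (\<lambda>x :: nat \<times> nat \<times> nat \<Rightarrow> 'a.
      \<Sum>\<pi> | \<pi> permutes {0..<r}. coeff (signof \<pi> * (\<Prod>i = 0..<r. jet_entry k x (\<rho> i) (\<gamma> (\<pi> i)))) l)"
    by (simp only: coeff_sum)
  show ?thesis unfolding eq
  proof (rule poly_fun_sum, rule coeff_mult_poly_fun)
    fix \<pi> l assume "\<pi> \<in> {\<pi>. \<pi> permutes {0..<r}}"
    then show "(\<lambda>x. coeff (\<Prod>i = 0..<r. jet_entry k x (\<rho> i) (\<gamma> (\<pi> i))) l) \<in> poly_fun (jet_vars m n k)"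
      by (intro coeff_prod_poly_fun entry) (auto simp: perm)
  qed (rule poly_fun.const)
qed

lemma zariski_closed_jet_det_variety:
  "zariski_closed (jet_vars m n k) (jet_det_variety m n r k :: (nat \<times> nat \<times> nat \<Rightarrow> 'a::field) set)"
proof -
  define I where "I = {(\<rho>, \<gamma>, l). strict_mono_on {..<r} \<rho> \<and> (\<forall>a<r. \<rho> a < m) \<and>
      strict_mono_on {..<r} \<gamma> \<and> (\<forall>b<r. \<gamma> b < n) \<and> l < k}"
  define f :: "(nat \<Rightarrow> nat) \<times> (nat \<Rightarrow> nat) \<times> nat \<Rightarrow> (nat \<times> nat \<times> nat \<Rightarrow> 'a) \<Rightarrow> 'a"
    where "f = (\<lambda>(\<rho>, \<gamma>, l) x. coeff (jet_minor r k x \<rho> \<gamma>) l)"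
  have "f i \<in> poly_fun (jet_vars m n k)" if i: "i \<in> I" for i
  proof -
    obtain \<rho> \<gamma> l where eq: "i = (\<rho>, \<gamma>, l)" by (cases i)
    show ?thesis unfolding eq f_def prod.case
      by (rule coeff_jet_minor_poly_fun) (use i in \<open>auto simp: eq I_def\<close>)
  qed
  moreover have "jet_det_variety m n r k = {x \<in> affine_space (jet_vars m n k). \<forall>p\<in>f ` I. p x = 0}"
    unfolding jet_det_variety_def I_def f_def by (simp add: split_paired_all) blast
  ultimately show ?thesis unfolding zariski_closed_def by (intro exI[of _ "f ` I"]) auto
qed

text \<open>The parameters w (i, j, l) with i < p are the coefficients of the first p rows; those with i = p
  are the coefficients of the combination of these rows that forms the last row.\<close>

definition span_param :: "nat \<Rightarrow> nat \<Rightarrow> nat \<Rightarrow> (nat \<times> nat \<times> nat \<Rightarrow> 'a::field) \<Rightarrow> nat \<times> nat \<times> nat \<Rightarrow> 'a" where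
  "span_param p n k w = (\<lambda>(i, j, l). if i < Suc p \<and> j < n \<and> l < k
     then if i < p then w (i, j, l) else \<Sum>i'<p. \<Sum>a\<le>l. w (p, i', a) * w (i', j, l - a) else 0)"

definition span_vars :: "nat \<Rightarrow> nat \<Rightarrow> nat \<Rightarrow> (nat \<times> nat \<times> nat) set" where
  "span_vars p n k = {..<p} \<times> {..<n} \<times> {..<k} \<union> {p} \<times> {..<p} \<times> {..<k}"

lemma finite_span_vars: "finite (span_vars p n k)"
  by (simp add: span_vars_def)

lemma card_span_vars: "card (span_vars p n k) = k * (p * (n + 1))"
  unfolding span_vars_def by (subst card_Un_disjoint) (auto simp: card_cartesian_product algebra_simps)

lemma span_param_affine: "span_param p n k w \<in> affine_space (jet_vars (Suc p) n k)"
  by (auto simp: affine_space_def span_param_def jet_vars_def)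

lemma span_param_poly_fun:
  assumes "v \<in> jet_vars (Suc p) n k"
  shows "(\<lambda>w :: nat \<times> nat \<times> nat \<Rightarrow> 'a::field. span_param p n k w v) \<in> poly_fun (span_vars p n k)"
proof -
  obtain i j l where v: "v = (i, j, l)" "i < Suc p" "j < n" "l < k"
    using assms by (auto simp: jet_vars_def)
  show ?thesis
  proof (cases "i < p")
    case True
    then have eq: "span_param p n k w v = w v" for w :: "nat \<times> nat \<times> nat \<Rightarrow> 'a"
      using v by (simp add: span_param_def)
    show ?thesis unfolding eq by (rule poly_fun.var) (use True v in \<open>simp add: span_vars_def\<close>)
  next
    case False
    then have eq: "span_param p n k w v = (\<Sum>i'<p. \<Sum>a\<le>l. w (p, i', a) * w (i', j, l - a))"
      for w :: "nat \<times> nat \<times> nat \<Rightarrow> 'a" using v by (simp add: span_param_def)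
    show ?thesis unfolding eq
      by (rule poly_fun_sum, rule poly_fun_sum, rule poly_fun.mult; rule poly_fun.var)
        (use v in \<open>auto simp: span_vars_def\<close>)
  qed
qed

text \<open>The vector (-c_0, ..., -c_(p-1), 1) annihilates the matrix modulo t^k. Its entry 1 turns
  divisibility of v_p * det into divisibility of the minor itself.\<close>

lemma span_param_variety: "span_param p n k w \<in> jet_det_variety (Suc p) n (Suc p) k"
  unfolding mem_jet_det_variety_iff
proof (intro conjI allI impI)
  show "span_param p n k w \<in> affine_space (jet_vars (Suc p) n k)" by (rule span_param_affine)
  fix \<gamma> assume \<gamma>: "\<forall>b<Suc p. \<gamma> b < n"
  define X where "X = jet_mat (Suc p) n k (span_param p n k w)"
  let ?M = "mat (Suc p) (Suc p) (\<lambda>(a, b). X $$ (a, \<gamma> b))"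
  \<comment> \<open>From t^k on the coefficients of \<open>c i\<close> are arbitrary values of
    \<open>w\<close>; only those below t^k enter the congruence.\<close>
  define c where "c i = Abs_fps (\<lambda>a. w (p, i, a))" for i
  define v where "v i = (if i < p then - c i else 1)" for i
  have X: "fps_nth (X $$ (i, j)) l = (if l < k then span_param p n k w (i, j, l) else 0)"
    if "i < Suc p" "j < n" for i j l using that by (simp add: X_def jet_mat_nth)
  have "fps_X ^ k dvd (\<Sum>i<Suc p. v i * ?M $$ (i, b))" if b: "b < Suc p" for b
    unfolding fps_X_power_dvd_iff
  proof (intro allI impI)
    fix l assume l: "l < k"
    have \<gamma>b: "\<gamma> b < n" using \<gamma> b by blast
    have "fps_nth (\<Sum>i<Suc p. v i * ?M $$ (i, b)) l
        = fps_nth (X $$ (p, \<gamma> b)) l - (\<Sum>i<p. fps_nth (c i * X $$ (i, \<gamma> b)) l)"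
      using b by (simp add: v_def fps_sum_nth sum_negf)
    also have "fps_nth (X $$ (p, \<gamma> b)) l = (\<Sum>i<p. \<Sum>a\<le>l. w (p, i, a) * w (i, \<gamma> b, l - a))"
      using l \<gamma>b by (simp add: X span_param_def)
    also have "(\<Sum>i<p. fps_nth (c i * X $$ (i, \<gamma> b)) l) = (\<Sum>i<p. \<Sum>a\<le>l. w (p, i, a) * w (i, \<gamma> b, l - a))"
      unfolding fps_mult_nth atLeast0AtMost
      using l \<gamma>b by (intro sum.cong refl) (simp add: X span_param_def c_def)
    finally show "fps_nth (\<Sum>i<Suc p. v i * ?M $$ (i, b)) l = 0" by simp
  qed
  then have "fps_X ^ k dvd v p * det ?M" by (intro left_kernel_dvd_det[of _ "Suc p"]) auto
  then show "fps_X ^ k dvd det (mat (Suc p) (Suc p)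
      (\<lambda>(a, b). jet_mat (Suc p) n k (span_param p n k w) $$ (a, \<gamma> b)))"
    by (simp add: v_def X_def)
qed

text \<open>A series with nonzero constant term is a unit, so the kernel relation can be divided by
  \<open>v p\<close> and solved modulo t^k for the last row.\<close>

lemma jet_of_in_range_span_param:
  fixes X :: "'a::field fps mat"
  assumes unit: "fps_nth (v p) 0 \<noteq> 0"
    and ker: "\<And>j. j < n \<Longrightarrow> fps_X ^ k dvd (\<Sum>i<Suc p. v i * X $$ (i, j))"
  shows "jet_of (Suc p) n k X \<in> range (span_param p n k)"
proof -
  define u where "u = inverse (v p)"
  define c where "c i = - (u * v i)" for i
  define w where "w = (\<lambda>(i, j, l). if i < p then fps_nth (X $$ (i, j)) l else fps_nth (c j) l)"
  have vp: "u * v p = 1" unfolding u_def using unit by (rule inverse_mult_eq_1)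
  have "jet_of (Suc p) n k X (i, j, l) = span_param p n k w (i, j, l)" for i j l
  proof (cases "i = p \<and> j < n \<and> l < k")
    case True
    have "(\<Sum>i<p. c i * X $$ (i, j)) = - (u * (\<Sum>i<p. v i * X $$ (i, j)))"
      by (simp add: c_def sum_distrib_left sum_negf mult.assoc)
    then have "u * (\<Sum>i<Suc p. v i * X $$ (i, j)) = (u * v p) * X $$ (p, j) - (\<Sum>i<p. c i * X $$ (i, j))"
      by (simp only: sum.lessThan_Suc distrib_left mult.assoc) simp
    then have eq: "u * (\<Sum>i<Suc p. v i * X $$ (i, j)) = X $$ (p, j) - (\<Sum>i<p. c i * X $$ (i, j))"
      by (simp only: vp mult_1_left)
    have "fps_X ^ k dvd u * (\<Sum>i<Suc p. v i * X $$ (i, j))"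
      by (rule dvd_mult, rule ker) (use True in simp)
    then have "fps_X ^ k dvd X $$ (p, j) - (\<Sum>i<p. c i * X $$ (i, j))" by (simp only: eq)
    then have "fps_nth (X $$ (p, j)) l = (\<Sum>i<p. fps_nth (c i * X $$ (i, j)) l)"
      using True by (simp add: fps_X_power_dvd_iff fps_sum_nth)
    also have "\<dots> = (\<Sum>i<p. \<Sum>a\<le>l. w (p, i, a) * w (i, j, l - a))"
      unfolding fps_mult_nth atLeast0AtMost by (intro sum.cong refl) (simp add: w_def)
    finally show ?thesis using True by (simp add: jet_of_def span_param_def)
  next
    case False
    then show ?thesis by (auto simp: jet_of_def span_param_def w_def)
  qed
  then have "jet_of (Suc p) n k X = span_param p n k w" by (intro ext) (metis prod_cases3)
  then show ?thesis by simp
qed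

section \<open>Deformations into the closure\<close>

lemma jet_of_affine: "jet_of m n k X \<in> affine_space (jet_vars m n k)"
  by (auto simp: jet_of_def affine_space_def jet_vars_def)

text \<open>An algebraic limit: over an infinite field a polynomial in \<open>s\<close> that
  vanishes off 0 vanishes at 0. The hypothesis speaks of the closure and not of \<open>T\<close>
  because the deformations are nested: points of the outer line may themselves be limits.\<close>

lemma jet_of_limit_on_line:
  fixes A B :: "'a::field fps mat"
  assumes inf: "infinite (UNIV :: 'a set)"
    and A: "A \<in> carrier_mat m n" and B: "B \<in> carrier_mat m n"
    and line: "\<And>s. s \<noteq> 0 \<Longrightarrow> jet_of m n k (A + fps_const s \<cdot>\<^sub>m B) \<in> zariski_closure (jet_vars m n k) T"
  shows "jet_of m n k A \<in> zariski_closure (jet_vars m n k) T"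
  unfolding zariski_closure_def
proof (intro CollectI conjI ballI impI jet_of_affine)
  fix p assume p: "p \<in> poly_fun (jet_vars m n k)" "\<forall>y\<in>T. p y = 0"
  let ?\<gamma> = "\<lambda>s. jet_of m n k (A + fps_const s \<cdot>\<^sub>m B)"
  have "\<exists>P. \<forall>s. ?\<gamma> s v = poly P s" if vV: "v \<in> jet_vars m n k" for v
  proof -
    obtain i j l where v: "v = (i, j, l)" "i < m" "j < n" "l < k" using vV by (auto simp: jet_vars_def)
    show ?thesis
      by (rule exI[of _ "[:fps_nth (A $$ (i, j)) l, fps_nth (B $$ (i, j)) l:]"])
        (use v A B in \<open>auto simp: jet_of_def\<close>)
  qed
  then obtain P where P: "\<And>s. p (?\<gamma> s) = poly P s" using poly_fun_curve[OF p(1), of ?\<gamma>] by blast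
  have "p (?\<gamma> s) = 0" if "s \<noteq> 0" for s
    using line[OF that] p unfolding zariski_closure_def by blast
  then have "poly P s = 0" if "s \<noteq> 0" for s using that by (simp only: P)
  then have "UNIV - {0} \<subseteq> {s. poly P s = 0}" by blast
  moreover have "infinite (UNIV - {0 :: 'a})" using inf by simp
  ultimately have "P = 0" using poly_roots_finite[of P] finite_subset[of "UNIV - {0}" "{s. poly P s = 0}"] by blast
  then have "p (?\<gamma> 0) = 0" using P[of 0] by simp
  moreover have "A + fps_const 0 \<cdot>\<^sub>m B = A" using A B by (intro eq_matI) auto
  ultimately show "p (jet_of m n k A) = 0" by simp
qed

text \<open>If \<open>v p\<close> is not a unit, subtract s times row p from row q and add s * v_q
  to v_p. The two changes cancel in the product, and the new last entry has constant term s *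
  v_q(0), nonzero for nonzero \<open>s\<close>.\<close>

lemma jet_of_closure_of_left_kernel:
  fixes X :: "'a::field fps mat"
  assumes inf: "infinite (UNIV :: 'a set)"
    and X: "X \<in> carrier_mat (Suc p) n" and q: "q < Suc p" and unit: "fps_nth (v q) 0 \<noteq> 0"
    and ker: "\<And>j. j < n \<Longrightarrow> fps_X ^ k dvd (\<Sum>i<Suc p. v i * X $$ (i, j))"
  shows "jet_of (Suc p) n k X \<in> zariski_closure (jet_vars (Suc p) n k) (range (span_param p n k))"
proof (cases "fps_nth (v p) 0 = 0")
  case False
  from jet_of_in_range_span_param[OF this ker] show ?thesis
    using zariski_closure_upper[of "range (span_param p n k)"] span_param_affine by blast
next
  case True
  then have qp: "q < p" using q unit by (cases "q = p") auto
  define B where "B = mat (Suc p) n (\<lambda>(i, j). if i = q then - X $$ (p, j) else 0)"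
  show ?thesis
  proof (rule jet_of_limit_on_line[OF inf X])
    show "B \<in> carrier_mat (Suc p) n" by (simp add: B_def)
    fix s :: 'a assume s: "s \<noteq> 0"
    define u where "u = v(p := v p + fps_const s * v q)"
    have "(\<Sum>i<Suc p. u i * (X + fps_const s \<cdot>\<^sub>m B) $$ (i, j)) = (\<Sum>i<Suc p. v i * X $$ (i, j))"
      if j: "j < n" for j
    proof -
      have "(\<Sum>i<p. u i * (X + fps_const s \<cdot>\<^sub>m B) $$ (i, j))
          = (\<Sum>i<p. v i * X $$ (i, j) - (if i = q then v i * fps_const s * X $$ (p, j) else 0))"
        using X j by (intro sum.cong) (auto simp: u_def B_def algebra_simps)
      also have "\<dots> = (\<Sum>i<p. v i * X $$ (i, j)) - v q * fps_const s * X $$ (p, j)"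
        using qp by (simp add: sum_subtractf)
      finally show ?thesis using X j qp by (simp add: u_def B_def algebra_simps)
    qed
    then have "fps_X ^ k dvd (\<Sum>i<Suc p. u i * (X + fps_const s \<cdot>\<^sub>m B) $$ (i, j))" if "j < n" for j
      using ker[OF that] that by simp
    moreover have "fps_nth (u p) 0 \<noteq> 0" using True unit s by (simp add: u_def)
    ultimately have "jet_of (Suc p) n k (X + fps_const s \<cdot>\<^sub>m B) \<in> range (span_param p n k)"
      by (intro jet_of_in_range_span_param)
    then show "jet_of (Suc p) n k (X + fps_const s \<cdot>\<^sub>m B)
        \<in> zariski_closure (jet_vars (Suc p) n k) (range (span_param p n k))"
      using zariski_closure_upper[of "range (span_param p n k)"] span_param_affine by blast
  qed
qed

text \<open>The kernel vector is found by back substitution from its last entry 1; it annihilates the first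
  column because d divides the product of the diagonal entries.\<close>

lemma superdiagonal_left_kernel:
  fixes D :: "'a::field fps mat"
  assumes D: "D \<in> carrier_mat (Suc p) n" and pn: "Suc p \<le> n"
    and diag: "\<And>i j. i < Suc p \<Longrightarrow> j < n \<Longrightarrow> i \<noteq> j \<Longrightarrow> D $$ (i, j) = 0"
    and prod: "d dvd (\<Prod>i<Suc p. D $$ (i, i))" and s: "s \<noteq> 0"
  shows "\<exists>U\<in>carrier_mat 1 (Suc p). U $$ (0, p) = 1 \<and> (\<forall>j<n. d dvd (U * (D + fps_const s \<cdot>\<^sub>m
    mat (Suc p) n (\<lambda>(i, j). of_bool (j = Suc i \<and> j < Suc p)))) $$ (0, j))"
proof -
  \<comment> \<open>The cut-off \<open>j < Suc p\<close> matters when n > p + 1: an entry at (p, p +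
    1) would contribute u_p * s = s to that column of the product.\<close>
  define N :: "'a fps mat" where "N = mat (Suc p) n (\<lambda>(i, j). of_bool (j = Suc i \<and> j < Suc p))"
  define r where "r = - fps_const (inverse s)"
  \<comment> \<open>Column i + 1 demands u_i * s + u_(i+1) * D_(i+1,i+1) = 0; descending from u_p =
    1, each step multiplies by -D_jj / s.\<close>
  define u where "u i = r ^ (p - i) * (\<Prod>j\<in>{Suc i..p}. D $$ (j, j))" for i
  define U where "U = mat 1 (Suc p) (\<lambda>(_, i). u i)"
  have U: "U \<in> carrier_mat 1 (Suc p)" by (simp add: U_def)
  have DN: "D + fps_const s \<cdot>\<^sub>m N \<in> carrier_mat (Suc p) n" using D by (simp add: N_def)
  have rs: "fps_const s * r = - 1" using s by (simp add: r_def)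
  have rec: "u i * fps_const s = - (u (Suc i) * D $$ (Suc i, Suc i))" if "i < p" for i
  proof -
    have "p - i = Suc (p - Suc i)" "{Suc i..p} = insert (Suc i) {Suc (Suc i)..p}" using that by auto
    then have "u i = r * (u (Suc i) * D $$ (Suc i, Suc i))" by (simp add: u_def)
    then have "u i * fps_const s = (fps_const s * r) * (u (Suc i) * D $$ (Suc i, Suc i))"
      by simp
    then show ?thesis by (simp only: rs) simp
  qed
  have "d dvd (U * (D + fps_const s \<cdot>\<^sub>m N)) $$ (0, j)" if j: "j < n" for j
  proof -
    have "(U * (D + fps_const s \<cdot>\<^sub>m N)) $$ (0, j)
        = (\<Sum>i<Suc p. U $$ (0, i) * (D + fps_const s \<cdot>\<^sub>m N) $$ (i, j))"
      by (rule index_mult_mat_sum[OF U DN _ j]) simp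
    also have "\<dots> = (\<Sum>i<Suc p. (if i = j then u i * D $$ (i, i) else 0)
        + (if Suc i = j \<and> j < Suc p then u i * fps_const s else 0))"
    proof (rule sum.cong[OF refl])
      fix i assume "i \<in> {..<Suc p}"
      then have i: "i < Suc p" by simp
      have "(D + fps_const s \<cdot>\<^sub>m N) $$ (i, j)
          = (if i = j then D $$ (i, i) else 0) + (if Suc i = j \<and> j < Suc p then fps_const s else 0)"
        using D i j diag[OF i j] by (cases "i = j") (auto simp: N_def)
      moreover have "U $$ (0, i) = u i" using i by (simp add: U_def)
      ultimately show "U $$ (0, i) * (D + fps_const s \<cdot>\<^sub>m N) $$ (i, j)
          = (if i = j then u i * D $$ (i, i) else 0)
            + (if Suc i = j \<and> j < Suc p then u i * fps_const s else 0)"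
        by (simp only: distrib_left if_distrib[of "\<lambda>x. u i * x"] mult_zero_right)
    qed
    finally have eq: "(U * (D + fps_const s \<cdot>\<^sub>m N)) $$ (0, j)
        = (\<Sum>i<Suc p. if i = j then u i * D $$ (i, i) else 0)
        + (\<Sum>i<Suc p. if Suc i = j \<and> j < Suc p then u i * fps_const s else 0)"
      by (simp only: sum.distrib)
    consider "j = 0" | "0 < j" "j < Suc p" | "Suc p \<le> j" by linarith
    then show ?thesis
    proof cases
      case 1
      have "{..<Suc p} = insert 0 {Suc 0..p}" by auto
      then have "(\<Prod>i<Suc p. D $$ (i, i)) = D $$ (0, 0) * (\<Prod>i\<in>{Suc 0..p}. D $$ (i, i))"
        by (simp del: prod.lessThan_Suc)
      then have "u 0 * D $$ (0, 0) = r ^ p * (\<Prod>i<Suc p. D $$ (i, i))"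
        by (simp only: u_def diff_zero mult_ac)
      moreover have "(U * (D + fps_const s \<cdot>\<^sub>m N)) $$ (0, j) = u 0 * D $$ (0, 0)"
        unfolding eq using 1 by (simp del: sum.lessThan_Suc)
      ultimately show ?thesis using prod by (simp only: dvd_mult)
    next
      case 2
      then obtain i where i: "j = Suc i" "i < p" by (cases j) auto
      have "(\<Sum>i'<Suc p. if Suc i' = j \<and> j < Suc p then u i' * fps_const s else 0)
          = (\<Sum>i'<Suc p. if i' = i then u i' * fps_const s else 0)"
        using i by (intro sum.cong) auto
      then have "(U * (D + fps_const s \<cdot>\<^sub>m N)) $$ (0, j) = u j * D $$ (j, j) + u i * fps_const s"
        unfolding eq using i by (simp del: sum.lessThan_Suc)
      also have "\<dots> = 0" using rec[OF i(2)] i(1) by simp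
      finally show ?thesis by simp
    next
      \<comment> \<open>Beyond the square block both \<open>D\<close> and \<open>N\<close> have zero
        columns.\<close>
      case 3
      have "(\<Sum>i<Suc p. if i = j then u i * D $$ (i, i) else 0) = 0"
        by (rule sum.neutral) (use 3 in auto)
      moreover have "(\<Sum>i<Suc p. if Suc i = j \<and> j < Suc p then u i * fps_const s else 0) = 0"
        by (rule sum.neutral) (use 3 in auto)
      ultimately show ?thesis unfolding eq by simp
    qed
  qed
  moreover have "U $$ (0, p) = 1" by (simp add: U_def u_def)
  ultimately show ?thesis using U unfolding N_def by blast
qed

lemma dvd_mult_mat_row:
  fixes A :: "'a::comm_ring_1 mat"
  assumes "A \<in> carrier_mat 1 n" "Q \<in> carrier_mat n q" "\<And>j. j < n \<Longrightarrow> d dvd A $$ (0, j)" "j < q"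
  shows "d dvd (A * Q) $$ (0, j)"
proof -
  have "(A * Q) $$ (0, j) = (\<Sum>k<n. A $$ (0, k) * Q $$ (k, j))"
    by (rule index_mult_mat_sum[OF assms(1,2) _ assms(4)]) simp
  moreover have "d dvd (\<Sum>k<n. A $$ (0, k) * Q $$ (k, j))"
    by (rule dvd_sum, rule dvd_mult2, rule assms(3)) simp
  ultimately show ?thesis by simp
qed

text \<open>Right multiplication by \<open>E\<close> cuts out the leading square block of
  \<open>D\<close>, which is diagonal. As D * E = P * (X * (Q * E)), its determinant is a multiple
  of det (X * (Q * E)), to which the Cauchy-Binet divisibility applies.\<close>

lemma diagonal_prod_dvd_of_minors:
  fixes X :: "'a::comm_ring_1 mat"
  assumes X: "X \<in> carrier_mat m n" and P: "P \<in> carrier_mat m m" and Q: "Q \<in> carrier_mat n n"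
    and mn: "m \<le> n" and D_eq: "D = P * X * Q"
    and diag: "\<And>i j. i < m \<Longrightarrow> j < n \<Longrightarrow> i \<noteq> j \<Longrightarrow> D $$ (i, j) = 0"
    and minors: "\<And>\<gamma>. strict_mono_on {..<m} \<gamma> \<Longrightarrow> (\<And>b. b < m \<Longrightarrow> \<gamma> b < n) \<Longrightarrow>
      d dvd det (mat m m (\<lambda>(a, b). X $$ (a, \<gamma> b)))"
  shows "d dvd (\<Prod>i<m. D $$ (i, i))"
proof -
  define E :: "'a mat" where "E = mat n m (\<lambda>(i, j). of_bool (i = j))"
  define F where "F = D * E"
  have E: "E \<in> carrier_mat n m" by (simp add: E_def)
  have D: "D \<in> carrier_mat m n" using P X Q by (simp add: D_eq)
  have F: "F \<in> carrier_mat m m" using D E by (simp add: F_def)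
  have entry: "F $$ (i, j) = D $$ (i, j)" if "i < m" "j < m" for i j
  proof -
    have "F $$ (i, j) = (\<Sum>k<n. D $$ (i, k) * E $$ (k, j))"
      unfolding F_def by (rule index_mult_mat_sum[OF D E that])
    also have "\<dots> = (\<Sum>k<n. if k = j then D $$ (i, k) else 0)"
      using that by (intro sum.cong) (auto simp: E_def)
    also have "\<dots> = D $$ (i, j)" using that mn by simp
    finally show ?thesis .
  qed
  have "upper_triangular F"
    unfolding upper_triangular_def using F mn by (auto simp: entry diag)
  then have "det F = prod_list (diag_mat F)" using F by (rule det_upper_triangular)
  also have "\<dots> = (\<Prod>i<m. D $$ (i, i))"
    unfolding prod_list_diag_prod atLeast0LessThan using F by (intro prod.cong) (auto simp: entry)
  finally have "(\<Prod>i<m. D $$ (i, i)) = det F" ..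
  also have "F = P * (X * (Q * E))"
    unfolding F_def D_eq
    using P X Q E by (simp add: assoc_mult_mat[of _ m m _ n _ m] assoc_mult_mat[of _ m n _ n _ m]
      assoc_mult_mat[of _ m m _ n _ n])
  also have "det \<dots> = det P * det (X * (Q * E))"
    using P X Q E by (intro det_mult[of _ m]) auto
  finally have eq: "(\<Prod>i<m. D $$ (i, i)) = det P * det (X * (Q * E))" .
  have "Q * E \<in> carrier_mat n m" using Q E by simp
  from det_mult_dvd_of_minors[OF X this minors] show ?thesis unfolding eq by (rule dvd_mult)
qed

text \<open>Undoing the change of coordinates carries the line D + s N to a line through X, and the
  kernel vector U to V = U * P, because V * (P' * Y * Q') = U * Y * Q'. The entry of V at position p
  need not be a unit, hence the need for a kernel criterion with the unit at any position.\<close>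

lemma jet_of_closure_of_minors:
  fixes X :: "'a::field fps mat"
  assumes inf: "infinite (UNIV :: 'a set)"
    and X: "X \<in> carrier_mat (Suc p) n" and pn: "Suc p \<le> n"
    and minors: "\<And>\<gamma>. strict_mono_on {..<Suc p} \<gamma> \<Longrightarrow> (\<And>b. b < Suc p \<Longrightarrow> \<gamma> b < n) \<Longrightarrow>
      fps_X ^ k dvd det (mat (Suc p) (Suc p) (\<lambda>(a, b). X $$ (a, \<gamma> b)))"
  shows "jet_of (Suc p) n k X \<in> zariski_closure (jet_vars (Suc p) n k) (range (span_param p n k))"
proof -
  let ?m = "Suc p"
  obtain D where D: "D \<in> carrier_mat ?m n" and XD: "mat_equivalent ?m n X D"
    and diag: "\<And>i j. i < ?m \<Longrightarrow> j < n \<Longrightarrow> i \<noteq> j \<Longrightarrow> D $$ (i, j) = 0"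
    using mat_equivalent_diagonal[OF fps_dvd_total X pn order_refl] by auto
  obtain P Q where P: "P \<in> carrier_mat ?m ?m" and Q: "Q \<in> carrier_mat n n"
    and units: "det P dvd 1" "det Q dvd 1" and DPQ: "D = P * X * Q"
    using XD unfolding mat_equivalent_def by blast
  obtain P' where P': "P' \<in> carrier_mat ?m ?m" "P * P' = 1\<^sub>m ?m" "P' * P = 1\<^sub>m ?m"
    using det_unit_inverse[OF P units(1)] by blast
  obtain Q' where Q': "Q' \<in> carrier_mat n n" "Q * Q' = 1\<^sub>m n"
    using det_unit_inverse[OF Q units(2)] by blast
  have "P' * (P * X * Q) * Q' = (P' * P) * X * (Q * Q')"
    using P P'(1) Q Q'(1) X
    by (simp add: assoc_mult_mat[of _ ?m ?m _ ?m _ n] assoc_mult_mat[of _ ?m ?m _ n _ n]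
      assoc_mult_mat[of _ ?m n _ n _ n])
  then have X_eq: "X = P' * D * Q'" unfolding DPQ P'(3) Q'(2) using X by simp
  have prod: "fps_X ^ k dvd (\<Prod>i<?m. D $$ (i, i))"
    by (rule diagonal_prod_dvd_of_minors[OF X P Q pn DPQ diag minors])
  define N :: "'a fps mat" where "N = mat ?m n (\<lambda>(i, j). of_bool (j = Suc i \<and> j < ?m))"
  have N: "N \<in> carrier_mat ?m n" by (simp add: N_def)
  have B: "P' * N * Q' \<in> carrier_mat ?m n" using P' N Q' by simp
  show ?thesis
  proof (rule jet_of_limit_on_line[OF inf X B])
    fix s :: 'a assume s: "s \<noteq> 0"
    define Y where "Y = D + fps_const s \<cdot>\<^sub>m N"
    have Y: "Y \<in> carrier_mat ?m n" using D N by (simp add: Y_def)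
    obtain U where U: "U \<in> carrier_mat 1 ?m" "U $$ (0, p) = 1"
      "\<And>j. j < n \<Longrightarrow> fps_X ^ k dvd (U * Y) $$ (0, j)"
      using superdiagonal_left_kernel[OF D pn diag prod s] unfolding Y_def N_def by blast
    have "P' * Y = P' * D + fps_const s \<cdot>\<^sub>m (P' * N)"
      unfolding Y_def using P'(1) D N
      by (simp add: mult_add_distrib_mat[of _ ?m ?m _ n] mult_smult_distrib[of _ ?m ?m _ n])
    then have line: "P' * Y * Q' = X + fps_const s \<cdot>\<^sub>m (P' * N * Q')"
      unfolding X_eq using P'(1) D N Q'(1)
      by (simp add: add_mult_distrib_mat[of _ ?m n _ _ n] mult_smult_assoc_mat[of _ ?m n _ n])
    have line_carrier: "P' * Y * Q' \<in> carrier_mat ?m n" using P' Y Q' by simp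
    define V where "V = U * P"
    have V: "V \<in> carrier_mat 1 ?m" using U P by (simp add: V_def)
    have VP': "V * P' = U"
      unfolding V_def using U(1) P P'(1) by (simp add: assoc_mult_mat[of _ 1 ?m _ ?m _ ?m] P'(2))
    have "V * (P' * Y * Q') = (V * P') * Y * Q'"
      using V P'(1) Y Q'(1) by (simp add: assoc_mult_mat[of _ 1 ?m _ ?m _ n]
        assoc_mult_mat[of _ 1 ?m _ n _ n] assoc_mult_mat[of _ ?m ?m _ n _ n])
    then have "V * (P' * Y * Q') = U * Y * Q'" by (simp only: VP')
    moreover have "U * Y \<in> carrier_mat 1 n" using U Y by simp
    ultimately have dvd: "fps_X ^ k dvd (V * (P' * Y * Q')) $$ (0, j)" if "j < n" for j
      using dvd_mult_mat_row[OF _ Q'(1) U(3) that] by simp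
    have ker: "fps_X ^ k dvd (\<Sum>i<?m. V $$ (0, i) * (P' * Y * Q') $$ (i, j))" if "j < n" for j
    proof -
      have "(V * (P' * Y * Q')) $$ (0, j) = (\<Sum>i<?m. V $$ (0, i) * (P' * Y * Q') $$ (i, j))"
        by (rule index_mult_mat_sum[OF V line_carrier _ that]) simp
      with dvd[OF that] show ?thesis by (simp only:)
    qed
    \<comment> \<open>If all constant terms of V vanished, so would those of V * P' = U, whose entry
      at p is 1.\<close>
    have "\<exists>q<?m. fps_nth (V $$ (0, q)) 0 \<noteq> 0"
    proof (rule ccontr)
      assume "\<not> ?thesis"
      then have V0: "fps_nth (V $$ (0, q)) 0 = 0" if "q < ?m" for q using that by blast
      have "U $$ (0, p) = (\<Sum>q<?m. V $$ (0, q) * P' $$ (q, p))"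
        using index_mult_mat_sum[OF V P'(1), of 0 p] VP' by simp
      then have "fps_nth (U $$ (0, p)) 0 = (\<Sum>q<?m. fps_nth (V $$ (0, q)) 0 * fps_nth (P' $$ (q, p)) 0)"
        by (simp add: fps_sum_nth del: sum.lessThan_Suc)
      also have "\<dots> = 0" by (rule sum.neutral) (simp add: V0)
      finally show False using U(2) by simp
    qed
    then obtain q where q: "q < ?m" "fps_nth (V $$ (0, q)) 0 \<noteq> 0" by blast
    have "jet_of ?m n k (P' * Y * Q') \<in> zariski_closure (jet_vars ?m n k) (range (span_param p n k))"
      using jet_of_closure_of_left_kernel[where v = "\<lambda>i. V $$ (0, i)", OF inf line_carrier q ker] .
    then show "jet_of ?m n k (X + fps_const s \<cdot>\<^sub>m (P' * N * Q'))
        \<in> zariski_closure (jet_vars ?m n k) (range (span_param p n k))"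
      by (simp only: line)
  qed
qed

lemma jet_det_variety_eq_closure:
  assumes inf: "infinite (UNIV :: 'a::field set)" and pn: "Suc p \<le> n"
  shows "(jet_det_variety (Suc p) n (Suc p) k :: (nat \<times> nat \<times> nat \<Rightarrow> 'a) set)
    = zariski_closure (jet_vars (Suc p) n k) (range (span_param p n k))"
proof (rule antisym)
  show "zariski_closure (jet_vars (Suc p) n k) (range (span_param p n k))
      \<subseteq> (jet_det_variety (Suc p) n (Suc p) k :: (nat \<times> nat \<times> nat \<Rightarrow> 'a) set)"
    using span_param_variety by (intro zariski_closure_least zariski_closed_jet_det_variety) blast
  show "(jet_det_variety (Suc p) n (Suc p) k :: (nat \<times> nat \<times> nat \<Rightarrow> 'a) set)
      \<subseteq> zariski_closure (jet_vars (Suc p) n k) (range (span_param p n k))"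
  proof
    fix x :: "nat \<times> nat \<times> nat \<Rightarrow> 'a"
    assume x: "x \<in> jet_det_variety (Suc p) n (Suc p) k"
    then have "x \<in> affine_space (jet_vars (Suc p) n k)"
      and minors: "\<And>\<gamma>. strict_mono_on {..<Suc p} \<gamma> \<Longrightarrow> (\<And>b. b < Suc p \<Longrightarrow> \<gamma> b < n) \<Longrightarrow>
        fps_X ^ k dvd det (mat (Suc p) (Suc p) (\<lambda>(a, b). jet_mat (Suc p) n k x $$ (a, \<gamma> b)))"
      unfolding mem_jet_det_variety_iff by blast+
    then show "x \<in> zariski_closure (jet_vars (Suc p) n k) (range (span_param p n k))"
      using jet_of_closure_of_minors[OF inf jet_mat_carrier pn minors] by (simp only: jet_of_jet_mat)
  qed
qed

text \<open>Freeing the coordinates one at a time, starting from the top block (I 0): the coefficients of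
  the combination come first, since only while the top block is constant are they coordinates of
  the matrix.\<close>

lemma irr_chain_span_param:
  assumes inf: "infinite (UNIV :: 'a::field set)" and pn: "Suc p \<le> n"
  shows "irr_chain (jet_vars (Suc p) n k)
    (zariski_closure (jet_vars (Suc p) n k) (range (span_param p n k :: _ \<Rightarrow> _ \<Rightarrow> 'a)))
    (card (span_vars p n k))"
proof -
  let ?V = "jet_vars (Suc p) n k"
  define \<psi> :: "(nat \<times> nat \<times> nat \<Rightarrow> 'a) \<Rightarrow> nat \<times> nat \<times> nat \<Rightarrow> 'a" where "\<psi> = span_param p n k"
  \<comment> \<open>Frozen values: the first p rows form the constant matrix (I 0), and the
    combination coefficients are 0.\<close>
  define base :: "nat \<times> nat \<times> nat \<Rightarrow> 'a" where "base = (\<lambda>(i, j, l). of_bool (i < p \<and> i = j \<and> l = 0))"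
  obtain xs where xs: "set xs = {p} \<times> {..<p} \<times> {..<k}" "distinct xs"
    using finite_distinct_list[of "{p} \<times> {..<p} \<times> {..<k}"] by auto
  obtain ys where ys: "set ys = {..<p} \<times> {..<n} \<times> {..<k}" "distinct ys"
    using finite_distinct_list[of "{..<p} \<times> {..<n} \<times> {..<k}"] by auto
  define zs where "zs = xs @ ys"
  have set_zs: "set zs = span_vars p n k" by (auto simp: zs_def xs ys span_vars_def)
  have dist: "distinct zs" using xs ys by (auto simp: zs_def)
  have len: "length zs = card (span_vars p n k)" using distinct_card[OF dist] set_zs by simp
  define L where "L i = {w. \<forall>v. v \<notin> set (take i zs) \<longrightarrow> w v = base v}" for i
  define C where "C i = zariski_closure ?V (\<psi> ` L i)" for i
  have \<psi>V: "\<psi> w \<in> affine_space ?V" for w unfolding \<psi>_def by (rule span_param_affine)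
  have irr: "zariski_irreducible ?V (C i)" for i
    unfolding C_def
  proof (rule zariski_irreducible_closure_image[OF inf \<psi>V])
    show "(\<lambda>w. \<psi> w v) \<in> poly_fun (span_vars p n k)" if "v \<in> ?V" for v
      unfolding \<psi>_def by (rule span_param_poly_fun[OF that])
    show "L i \<noteq> {}" by (auto simp: L_def)
    show "(\<lambda>v. x v + s * (y v - x v)) \<in> L i" if "x \<in> L i" "y \<in> L i" for x y s
      using that by (simp add: L_def)
  qed
  \<comment> \<open>Each parameter triple is also the index of a matrix entry; when it has just been
    freed, its value can be read off from that entry.\<close>
  have coord: "\<psi> w (zs ! i) = w (zs ! i)" if i: "i < length zs" and w: "w \<in> L (Suc i)" for w i
  proof (cases "i < length xs")
    case False
    then have "zs ! i \<in> set ys" using i by (auto simp: zs_def nth_append)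
    then obtain i' j l where "zs ! i = (i', j, l)" "i' < p" "j < n" "l < k" by (auto simp: ys)
    then show ?thesis by (simp add: \<psi>_def span_param_def)
  next
    case True
    then have "zs ! i \<in> set xs" by (simp add: zs_def nth_append)
    then obtain j l where e: "zs ! i = (p, j, l)" "j < p" "l < k" by (auto simp: xs)
    have "set (take (Suc i) zs) \<subseteq> set xs" using True set_take_subset[of "Suc i" xs] by (simp add: zs_def)
    then have "(i', j', l') \<notin> set (take (Suc i) zs)" if "i' < p" for i' j' l'
      using that by (auto simp: xs)
    then have w_base: "w (i', j', l') = of_bool (i' = j' \<and> l' = 0)" if "i' < p" for i' j' l'
      using w that unfolding L_def by (simp add: base_def)
    have "\<psi> w (p, j, l) = (\<Sum>i'<p. \<Sum>a\<le>l. w (p, i', a) * w (i', j, l - a))"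
      using e pn by (simp add: \<psi>_def span_param_def)
    \<comment> \<open>Against (I 0) the convolution retains only the term i' = j, a = l.\<close>
    also have "\<dots> = (\<Sum>i'<p. \<Sum>a\<le>l. if a = l then (if i' = j then w (p, i', a) else 0) else 0)"
      by (intro sum.cong refl) (auto simp: w_base)
    also have "\<dots> = w (p, j, l)" using e by simp
    finally show ?thesis using e by simp
  qed
  have "C i \<subset> C (Suc i)" if i: "i < card (span_vars p n k)" for i
  proof
    have i: "i < length zs" using i len by simp
    define e where "e = zs ! i"
    have "e \<in> span_vars p n k" using i set_zs nth_mem[of i zs] by (simp add: e_def)
    then have eV: "e \<in> ?V" using pn by (auto simp: span_vars_def jet_vars_def)
    have e_notin: "e \<notin> set (take i zs)"
      using dist i unfolding e_def by (auto simp: in_set_conv_nth nth_eq_iff_index_eq)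
    have take_Suc: "set (take (Suc i) zs) = insert e (set (take i zs))"
      using i by (simp add: take_Suc_conv_app_nth e_def)
    have L_sub: "L i \<subseteq> L (Suc i)" unfolding L_def take_Suc by blast
    then show "C i \<subseteq> C (Suc i)" unfolding C_def by (intro zariski_closure_mono image_mono)
    \<comment> \<open>At \<open>\<psi> w\<close> the function x e - base e has the value 1, whereas
      it vanishes on the image of \<open>L i\<close>, where \<open>e\<close> is still
      frozen.\<close>
    define w where "w = base(e := base e + 1)"
    have w: "w \<in> L (Suc i)" unfolding L_def take_Suc by (simp add: w_def)
    then have "\<psi> w \<in> C (Suc i)"
      unfolding C_def using zariski_closure_upper[of "\<psi> ` L (Suc i)" ?V] \<psi>V by blast
    moreover have "\<psi> w \<notin> C i"
    proof
      assume "\<psi> w \<in> C i"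
      then have *: "q (\<psi> w) = 0" if "q \<in> poly_fun ?V" "\<And>w'. w' \<in> L i \<Longrightarrow> q (\<psi> w') = 0" for q
        using that unfolding C_def zariski_closure_def by blast
      have "\<psi> w e - base e = 0"
      proof (rule *[of "\<lambda>x. x e - base e"])
        show "(\<lambda>x. x e - base e) \<in> poly_fun ?V"
          by (rule poly_fun_minus[OF poly_fun.var[OF eV] poly_fun.const])
        fix w' assume w': "w' \<in> L i"
        have "\<psi> w' e = w' e" using coord[OF i] L_sub w' unfolding e_def by blast
        also have "w' e = base e" using w' e_notin unfolding L_def by blast
        finally show "\<psi> w' e - base e = 0" by simp
      qed
      then show False using coord[OF i w] by (simp add: e_def[symmetric] w_def)
    qed
    ultimately show "C i \<noteq> C (Suc i)" by blast
  qed
  moreover have "C (card (span_vars p n k)) \<subseteq> zariski_closure ?V (range \<psi>)"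
    unfolding C_def by (intro zariski_closure_mono) blast
  ultimately show ?thesis
    unfolding irr_chain_def \<psi>_def[symmetric] by (intro exI[of _ C] conjI allI impI irr)
qed

section \<open>Dimension count and conclusion\<close>

lemma card_jet_vars: "card (jet_vars m n k) = m * n * k"
proof -
  have "jet_vars m n k = {..<m} \<times> {..<n} \<times> {..<k}" by (auto simp: jet_vars_def)
  then show ?thesis by (simp add: card_cartesian_product)
qed

theorem theorem3p1:
  fixes m n k :: nat
  assumes "alg_closed TYPE('a::field)"
    and "1 \<le> m" and "m \<le> n" and "1 \<le> k"
  shows "zariski_irreducible (jet_vars m n k) (jet_det_variety m n m k :: (nat \<times> nat \<times> nat \<Rightarrow> 'a) set)
       \<and> zariski_codim (jet_vars m n k) (jet_det_variety m n m k :: (nat \<times> nat \<times> nat \<Rightarrow> 'a) set)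
            (k * (n - m + 1))"
proof -
  have inf: "infinite (UNIV :: 'a set)" by (rule alg_closed_infinite[OF assms(1)])
  obtain p where m: "m = Suc p" using assms(2) by (cases m) auto
  then have pn: "Suc p \<le> n" using assms(3) by simp
  let ?V = "jet_vars m n k"
  let ?Z = "jet_det_variety m n m k :: (nat \<times> nat \<times> nat \<Rightarrow> 'a) set"
  have Z: "?Z = zariski_closure ?V (range (span_param p n k))"
    unfolding m by (rule jet_det_variety_eq_closure[OF inf pn])
  have irr: "zariski_irreducible ?V ?Z"
    unfolding Z unfolding m
    by (rule zariski_irreducible_closure_image[OF inf span_param_affine span_param_poly_fun]) auto
  \<comment> \<open>Writing n as p + 1 + q removes the truncated subtraction and leaves the identity
    (p + 1) n = (q + 1) + p (n + 1).\<close>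
  obtain q where q: "n = Suc p + q" using pn by (auto simp: le_iff_add)
  have codim: "card ?V = k * (n - m + 1) + card (span_vars p n k)"
    unfolding card_jet_vars card_span_vars m q by (simp add: algebra_simps)
  have "irr_chain ?V ?Z (card (span_vars p n k))"
    unfolding Z unfolding m by (rule irr_chain_span_param[OF inf pn])
  moreover have "\<not> irr_chain ?V ?Z (Suc (card (span_vars p n k)))"
    by (rule irr_chain_bound[OF finite_span_vars _ equalityD1[OF Z]]) (simp add: span_param_poly_fun m)
  ultimately have "zariski_codim ?V ?Z (k * (n - m + 1))"
    unfolding zariski_codim_def zariski_dim_def codim by simp
  with irr show ?thesis by blast
qed

end
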